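(* Let $X$ and $\mu=\mu_{(p,q,\mathcal N)}$ be as in the context, under the standing assumptions. Then: (1) For every $x\in X=\operatorname{supp}(\mu)$, $$-\frac{\log(1-p)}{\log A}\le \underline{\dim}_{\rm loc}(\mu,x)\le -\frac{\log p}{\log A}\quad\text{and}\quad -\frac{\log(1-q)}{\log B}\le \overline{\dim}_{\rm loc}(\mu,x)\le -\frac{\log q}{\log B}.$$ (2) $\underline{\dim}_{\rm loc}(\mu,x)<\overline{\dim}_{\rm loc}(\mu,x)$ for every $x\in X$; in particular the local dimension of $\mu$ exists at no point of its support. (3) For $\mu$-almost every $x\in X$, $$\underline{\dim}_{\rm loc}(\mu,x)=\frac{H(p)}{\log A},\qquad \overline{\dim}_{\rm loc}(\mu,x)=\frac{H(q)}{\log B},$$ where $H(p)=-p\log p-(1-p)\log(1-p)$. (4) $\dim_H X=\frac{\log 2}{\log A}<\dim_P X=\frac{\log 2}{\log B}$.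
   Context: Let $\mathcal A=\{0,1\}$. Fix real numbers $A>B>2$, real numbers $p,q$ with $0<p,q\le 1/2$, and a strictly increasing sequence of integers $\mathcal N=(N_i)_{i\ge 0}$ with $N_0=0$. For $n\ge 1$, call $n$ of type A if $N_{2i}<n\le N_{2i+1}$ for some $i\ge 0$, and of type B if $N_{2i+1}<n\le N_{2i+2}$ for some $i\ge0$; put $(r_n,\rho_n)=(A,p)$ if $n$ is of type A and $(r_n,\rho_n)=(B,q)$ if $n$ is of type B. Define closed intervals $I_w$, $w\in\mathcal A^n$, recursively: $I_\emptyset=[0,1]$, and if $w\in\mathcal A^{n-1}$ and $I_w=[x_w,x_w+\ell]$ then $I_{w0}=[x_w,x_w+\ell/r_n]$ and $I_{w1}=[x_w+\ell-\ell/r_n,\,x_w+\ell]$. Let $X=X(A,B,\mathcal N)=\bigcap_{n\ge1}\bigcup_{w\in\mathcal A^n}I_w$. Let $\mu=\mu_{(p,q,\mathcal N)}$ be the unique Borel probability measure on $X$ with $\mu(I_\emptyset)=1$ and, for $w\in\mathcal A^{n-1}$, $\mu(I_{w0})=\rho_n\mu(I_w)$, $\mu(I_{w1})=(1-\rho_n)\mu(I_w)$; its support is $X$. Standing assumptions: $\lim_{i\to\infty}N_{i+1}/N_i=\infty$ and $-\frac{\log p}{\log A}<-\frac{\log(1-q)}{\log B}$. For a Borel probability measure $\nu$ on $\mathbb R$ and $x$, the lower and upper local dimensions are $\underline{\dim}_{\rm loc}(\nu,x)=\liminf_{r\to0^+}\frac{\log\nu(B(x,r))}{\log r}$ and $\overline{\dim}_{\rm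 loc}(\nu,x)=\limsup_{r\to0^+}\frac{\log\nu(B(x,r))}{\log r}$, where $B(x,r)$ is the closed ball. $\dim_H$, $\dim_P$ denote Hausdorff and packing dimension. *)

theory Defs
  imports "HOL-Analysis.Analysis" "HOL-Probability.Probability"
begin

definition typeA :: "(nat \<Rightarrow> nat) \<Rightarrow> nat \<Rightarrow> bool" where
  "typeA N n \<longleftrightarrow> (\<exists>i. N (2*i) < n \<and> n \<le> N (2*i+1))"

definition ratio :: "real \<Rightarrow> real \<Rightarrow> (nat \<Rightarrow> nat) \<Rightarrow> nat \<Rightarrow> real" where
  "ratio A B N n = (if typeA N n then A else B)"

definition rho :: "real \<Rightarrow> real \<Rightarrow> (nat \<Rightarrow> nat) \<Rightarrow> nat \<Rightarrow> real" where
  "rho p q N n = (if typeA N n then p else q)"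

definition cyl_len :: "real \<Rightarrow> real \<Rightarrow> (nat \<Rightarrow> nat) \<Rightarrow> nat \<Rightarrow> real" where
  "cyl_len A B N n = (\<Prod>k\<in>{1..n}. 1 / ratio A B N k)"

text \<open>Left endpoint of I_w, computed on the REVERSED word (last letter first),
  following the recursion I_{w0}, I_{w1}. Letters: False = 0, True = 1.\<close>
primrec cyl_left_rev :: "real \<Rightarrow> real \<Rightarrow> (nat \<Rightarrow> nat) \<Rightarrow> bool list \<Rightarrow> real" where
  "cyl_left_rev A B N [] = 0"
| "cyl_left_rev A B N (b # v) =
     (if b then cyl_left_rev A B N v + cyl_len A B N (length v)
                 - cyl_len A B N (length v) / ratio A B N (Suc (length v))
      else cyl_left_rev A B N v)"

definition cyl :: "real \<Rightarrow> real \<Rightarrow> (nat \<Rightarrow> nat) \<Rightarrow> bool list \<Rightarrow> real set" where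
  "cyl A B N w = {cyl_left_rev A B N (rev w) .. cyl_left_rev A B N (rev w) + cyl_len A B N (length w)}"

definition cantorX :: "real \<Rightarrow> real \<Rightarrow> (nat \<Rightarrow> nat) \<Rightarrow> real set" where
  "cantorX A B N = (\<Inter>n\<in>{1..}. \<Union>w\<in>{w. length w = n}. cyl A B N w)"

text \<open>mu(I_w), again on the reversed word.\<close>
primrec weight_rev :: "real \<Rightarrow> real \<Rightarrow> (nat \<Rightarrow> nat) \<Rightarrow> bool list \<Rightarrow> real" where
  "weight_rev p q N [] = 1"
| "weight_rev p q N (b # v) =
     (if b then 1 - rho p q N (Suc (length v)) else rho p q N (Suc (length v))) * weight_rev p q N v"

definition weight :: "real \<Rightarrow> real \<Rightarrow> (nat \<Rightarrow> nat) \<Rightarrow> bool list \<Rightarrow> real" where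
  "weight p q N w = weight_rev p q N (rev w)"

text \<open>log(nu(B(x,r)))/log r, with log 0 = -infinity, i.e. value +infinity if the ball is null.\<close>
definition loc_ratio :: "real measure \<Rightarrow> real \<Rightarrow> real \<Rightarrow> ereal" where
  "loc_ratio \<nu> x r = (if measure \<nu> (cball x r) > 0
      then ereal (ln (measure \<nu> (cball x r)) / ln r) else \<infinity>)"

definition lower_local_dim :: "real measure \<Rightarrow> real \<Rightarrow> ereal" where
  "lower_local_dim \<nu> x = Liminf (at_right 0) (loc_ratio \<nu> x)"

definition upper_local_dim :: "real measure \<Rightarrow> real \<Rightarrow> ereal" where
  "upper_local_dim \<nu> x = Limsup (at_right 0) (loc_ratio \<nu> x)"

definition hausdorff_pre :: "real \<Rightarrow> real \<Rightarrow> real set \<Rightarrow> ennreal" where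
  "hausdorff_pre s \<delta> E = Inf {(\<Sum>i. ennreal (diameter (U i) powr s)) | U :: nat \<Rightarrow> real set.
      E \<subseteq> (\<Union>i. U i) \<and> (\<forall>i. bounded (U i) \<and> diameter (U i) \<le> \<delta>)}"

definition hausdorff_measure :: "real \<Rightarrow> real set \<Rightarrow> ennreal" where
  "hausdorff_measure s E = (SUP \<delta>\<in>{0<..}. hausdorff_pre s \<delta> E)"

definition hausdorff_dim :: "real set \<Rightarrow> ereal" where
  "hausdorff_dim E = Inf {ereal s | s. 0 \<le> s \<and> hausdorff_measure s E = 0}"

text \<open>delta-packings of E: countably many pairwise disjoint closed balls centred in E
  with radii at most delta (radius 0 entries are dummies contributing 0).\<close>
definition packing_pre_delta :: "real \<Rightarrow> real \<Rightarrow> real set \<Rightarrow> ennreal" where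
  "packing_pre_delta s \<delta> E = Sup {(\<Sum>i. ennreal ((2 * \<rho> i) powr s)) | c \<rho>.
      (\<forall>i. c i \<in> E \<and> 0 \<le> \<rho> i \<and> \<rho> i \<le> \<delta>) \<and>
      (\<forall>i j. i \<noteq> j \<and> 0 < \<rho> i \<and> 0 < \<rho> j \<longrightarrow> cball (c i) (\<rho> i) \<inter> cball (c j) (\<rho> j) = {})}"

definition packing_premeasure :: "real \<Rightarrow> real set \<Rightarrow> ennreal" where
  "packing_premeasure s E = (INF \<delta>\<in>{0<..}. packing_pre_delta s \<delta> E)"

definition packing_measure :: "real \<Rightarrow> real set \<Rightarrow> ennreal" where
  "packing_measure s E = Inf {(\<Sum>i. packing_premeasure s (F i)) | F :: nat \<Rightarrow> real set.
      E \<subseteq> (\<Union>i. F i)}"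

definition packing_dim :: "real set \<Rightarrow> ereal" where
  "packing_dim E = Inf {ereal s | s. 0 \<le> s \<and> packing_measure s E = 0}"

definition entropy :: "real \<Rightarrow> real" where
  "entropy p = - p * ln p - (1 - p) * ln (1 - p)"

end

theory Submission
  imports Defs
begin

text \<open>
  Distinct cylinders of length n are separated by a fixed multiple of the length of their parents, so
  up to a bounded shift of n the ball of radius r around a point x of X carries the mass of the
  cylinder around x whose length is comparable to r. Hence the local dimensions at x are the lower and
  upper limits of (- ln of the mass) / (- ln of the length) along the cylinders around x. Numerator and
  denominator are sums over the levels 1, ..., n, and since N (i + 1) / N i tends to infinity, the
  averages at n = N (2 i + 1) see only type A and those at n = N (2 i + 2) only type B. The mass sums are
  bounded letter by letter in part (1); for part (3) a fourth moment bound and Borel--Cantelli replace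
  them by sums of entropies.

  For part (4) the cylinders at the levels N (2 i + 1) give economical covers. The lower bound for the
  Hausdorff dimension and the upper bound for the packing dimension compare with the
  measure for p = q = 1/2. For the lower bound on the packing dimension, a Baire category argument
  makes one piece of any countable cover dense in some cylinder, and such a piece contains large
  packings at the levels N (2 i + 2).
\<close>

section \<open>Words of fixed length, limits along subsequences, entropy\<close>

lemma finite_words: "finite {w :: bool list. length w = n}"
  using finite_lists_length_eq[of "UNIV :: bool set" n] by simp

lemma card_words: "card {w :: bool list. length w = n} = 2 ^ n"
  using card_lists_length_eq[of "UNIV :: bool set" n] by simp

lemma enumerate_words:
  obtains f :: "nat \<Rightarrow> bool list" where "bij_betw f {..<2 ^ n} {w. length w = n}"
  using ex_bij_betw_nat_finite[OF finite_words[of n]] by (auto simp: card_words atLeast0LessThan)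

lemma words_Suc:
  "{w. length w = Suc n} = (\<lambda>w. w @ [False]) ` {w. length w = n} \<union> (\<lambda>w. w @ [True]) ` {w. length w = n}"
proof (intro set_eqI iffI)
  fix w :: "bool list" assume "w \<in> {w. length w = Suc n}"
  then obtain v b where "w = v @ [b]" "length v = n" by (cases w rule: rev_cases) auto
  then show "w \<in> (\<lambda>w. w @ [False]) ` {w. length w = n} \<union> (\<lambda>w. w @ [True]) ` {w. length w = n}"
    by (cases b) auto
qed auto

lemma sum_words_Suc:
  fixes f :: "bool list \<Rightarrow> real"
  shows "(\<Sum>w | length w = Suc n. f w) = (\<Sum>w | length w = n. f (w @ [False]) + f (w @ [True]))"
  unfolding words_Suc
  by (subst sum.union_disjoint)
     (auto simp: finite_words sum.reindex inj_on_def sum.distrib)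

text \<open>Lets a lower bound on a local dimension be proved through real thresholds, although the
  dimension may a priori be infinite.\<close>

lemma ereal_leI_real:
  assumes "\<And>t. t < s \<Longrightarrow> ereal t \<le> y"
  shows "ereal s \<le> y"
proof (rule dense_le_bounded[of "-\<infinity>"])
  fix w :: ereal assume "-\<infinity> < w" "w < ereal s"
  then show "w \<le> y" using assms by (cases w) auto
qed simp

lemma frequently_subseq:
  assumes "filterlim g at_top sequentially" "\<forall>\<^sub>F i in sequentially. P (g i :: nat)"
  shows "\<exists>\<^sub>F n in sequentially. P n"
  unfolding frequently_def
proof
  assume "\<forall>\<^sub>F n in sequentially. \<not> P n"
  then have "\<forall>\<^sub>F i in sequentially. \<not> P (g i)"
    using assms(1) by (rule eventually_compose_filterlim)
  then have "\<forall>\<^sub>F i in sequentially. False"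
    using assms(2) by eventually_elim simp
  then show False by simp
qed

text \<open>Absorbs constants, such as the information lost in shifting a level, into an error
  proportional to the level.\<close>

lemma eventually_const_le:
  fixes c e :: real
  assumes "0 < e"
  shows "\<forall>\<^sub>F n in sequentially. c \<le> e * real n"
proof -
  obtain m :: nat where "c / e \<le> real m" using real_arch_simple by blast
  have "c \<le> e * real n" if "m \<le> n" for n
  proof -
    have "c / e \<le> real n" using that \<open>c / e \<le> real m\<close> by (meson of_nat_le_iff order_trans)
    then show ?thesis using assms by (simp add: field_simps)
  qed
  then show ?thesis by (auto simp: eventually_sequentially)
qed

text \<open>The entropy is the mean of \<open>- ln s\<close> and \<open>- ln (1 - s)\<close> with
  weights \<open>s\<close> and \<open>1 - s\<close>, hence lies between them;
  \<open>s \<le> 1/2\<close> makes \<open>- ln s\<close> the larger one.\<close>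

lemma entropy_pos_bounds:
  assumes "0 < s" "s \<le> 1/2"
  shows "0 < entropy s" "entropy s \<le> - ln s" "- ln (1 - s) \<le> entropy s"
proof -
  have *: "ln s \<le> ln (1 - s)" "ln s < 0" "ln (1 - s) < 0" using assms by auto
  have eq: "entropy s = s * (- ln s) + (1 - s) * (- ln (1 - s))" by (simp add: Defs.entropy_def)
  show "0 < entropy s" unfolding eq using * assms by (intro add_pos_pos mult_pos_pos) auto
  have "(1 - s) * (- ln (1 - s)) \<le> (1 - s) * (- ln s)" using * assms by (intro mult_left_mono) auto
  then show "entropy s \<le> - ln s" unfolding eq by (simp add: algebra_simps)
  have "s * (- ln (1 - s)) \<le> s * (- ln s)" using * assms by (intro mult_left_mono) auto
  then show "- ln (1 - s) \<le> entropy s" unfolding eq by (simp add: algebra_simps)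
qed

lemma weight_half: "weight (1/2) (1/2) N w = (1/2) ^ length w"
proof -
  have "weight_rev (1/2) (1/2) N v = (1/2) ^ length v" for v
    by (induction v) (auto simp: rho_def)
  then show ?thesis by (simp add: weight_def)
qed

lemma packing_premeasure_empty: "packing_premeasure s {} = 0"
proof -
  have "packing_premeasure s {} \<le> packing_pre_delta s 1 {}"
    unfolding packing_premeasure_def by (rule INF_lower) simp
  also have "\<dots> = 0" by (simp add: packing_pre_delta_def bot_ennreal)
  finally show ?thesis by simp
qed

subsection \<open>Geometry of the cylinders\<close>

text \<open>The geometric data are kept apart from the measure, so that
  \<open>cantor_measure\<close> can be instantiated over the same set both for \<mu> and for the
  fair coin measure.\<close>

locale cantor_scheme =
  fixes A B :: real and N :: "nat \<Rightarrow> nat"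
  assumes B_gt_2: "2 < B" and A_gt_B: "B < A"
    and mono_N: "strict_mono N"
    and N_ratio: "filterlim (\<lambda>i. real (N (Suc i)) / real (N i)) at_top sequentially"
begin

abbreviation "len \<equiv> cyl_len A B N"
abbreviation "I \<equiv> cyl A B N"
abbreviation "X \<equiv> cantorX A B N"

definition left_end :: "bool list \<Rightarrow> real" where
  "left_end w = cyl_left_rev A B N (rev w)"

text \<open>The two children of an interval leave free the fraction \<open>1 - 2 / ratio\<close> of
  it; this is the smaller of the two possible values.\<close>

definition gap :: real where
  "gap = 1 - 2 / B"

lemma gap_pos: "0 < gap"
  using B_gt_2 by (simp add: gap_def)

lemma ratio_bounds: "B \<le> ratio A B N k" "ratio A B N k \<le> A"
  using A_gt_B by (auto simp: ratio_def)

lemma ratio_gt_2: "2 < ratio A B N k"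
  using ratio_bounds(1)[of k] B_gt_2 by simp

lemma len_0 [simp]: "len 0 = 1"
  by (simp add: cyl_len_def)

lemma len_Suc: "len (Suc n) = len n / ratio A B N (Suc n)"
  by (simp add: cyl_len_def)

lemma len_pos: "0 < len n"
  using ratio_gt_2 by (auto simp: cyl_len_def intro!: prod_pos) (smt (verit))

lemma len_Suc_less: "len (Suc n) < len n"
  using len_pos[of n] ratio_gt_2[of "Suc n"] by (simp add: len_Suc divide_less_eq)

lemma len_antimono: "m \<le> n \<Longrightarrow> len n \<le> len m"
  by (metis decseq_SucI decseq_def len_Suc_less less_imp_le)

lemma B_power_len_le: "B ^ k * len (n + k) \<le> len n"
proof (induction k)
  case (Suc k)
  have "B * len (Suc (n + k)) \<le> len (n + k)"
    using len_pos[of "n + k"] ratio_bounds(1)[of "Suc (n + k)"] ratio_gt_2[of "Suc (n + k)"]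
    by (simp add: len_Suc divide_simps mult.commute)
  then have "B ^ k * (B * len (Suc (n + k))) \<le> B ^ k * len (n + k)"
    using B_gt_2 by (intro mult_left_mono) auto
  with Suc show ?case by (simp add: algebra_simps)
qed simp

lemma len_tendsto_0: "len \<longlonglongrightarrow> 0"
proof (rule tendsto_sandwich[of "\<lambda>_. 0" _ _ "\<lambda>n. (1 / B) ^ n"])
  show "\<forall>\<^sub>F n in sequentially. len n \<le> (1 / B) ^ n"
    using B_power_len_le[of _ 0] B_gt_2
    by (intro always_eventually) (auto simp: field_simps)
  show "(\<lambda>n. (1 / B) ^ n) \<longlonglongrightarrow> 0"
    using B_gt_2 by (intro LIMSEQ_realpow_zero) auto
qed (auto simp: len_pos less_imp_le)

lemma I_eq: "I w = {left_end w .. left_end w + len (length w)}"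
  by (simp add: cyl_def left_end_def)

lemma left_end_Nil [simp]: "left_end [] = 0"
  by (simp add: left_end_def)

lemma left_end_snoc:
  "left_end (w @ [b]) = (if b then left_end w + len (length w) - len (Suc (length w)) else left_end w)"
  by (simp add: left_end_def len_Suc)

lemma left_end_in: "left_end w \<in> I w"
  using len_pos[of "length w"] by (simp add: I_eq)

lemma I_snoc_subset: "I (w @ [b]) \<subseteq> I w"
  using len_Suc_less[of "length w"] by (auto simp: I_eq left_end_snoc)

lemma I_append_subset: "I (v @ w) \<subseteq> I v"
proof (induction w rule: rev_induct)
  case (snoc b w)
  then show ?case using I_snoc_subset[of "v @ w" b] by simp
qed simp

lemma I_take_subset: "I w \<subseteq> I (take n w)"
  using I_append_subset[of "take n w" "drop n w"] by simp

lemma closed_I: "closed (I w)"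
  by (simp add: I_eq)

text \<open>Two words part at some letter; the points then lie in different children of a common
  ancestor, whose hole is at least \<open>gap\<close> times its length. The bound is weakest when
  the words part only at the last letter, which gives \<open>len n\<close>.\<close>

lemma I_separated:
  assumes "length v = Suc n" "length w = Suc n" "v \<noteq> w" "x \<in> I v" "y \<in> I w"
  shows "gap * len n \<le> \<bar>x - y\<bar>"
  using assms
proof (induction n arbitrary: v w)
  case (0 v w)
  have "length v = 1" "length w = 1" using 0 by auto
  then obtain a b where "v = [] @ [a]" "w = [] @ [b]"
    by (metis One_nat_def append_Nil length_0_conv length_Suc_conv)
  moreover have "len 1 \<le> 1 / B"
    using B_power_len_le[of 1 0] B_gt_2 by (simp add: field_simps)
  moreover have "left_end [True] = 1 - len 1" "left_end [False] = 0"
    using left_end_snoc[of "[]"] by auto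
  ultimately show ?case
    using 0 unfolding I_eq gap_def by (cases a; cases b) auto
next
  case (Suc n v w)
  obtain v' a where v: "v = v' @ [a]" using Suc.prems(1) by (cases v rule: rev_cases) auto
  obtain w' b where w: "w = w' @ [b]" using Suc.prems(2) by (cases w rule: rev_cases) auto
  have lens: "length v' = Suc n" "length w' = Suc n" using Suc.prems v w by auto
  show ?case
  proof (cases "v' = w'")
    case False
    have "gap * len n \<le> \<bar>x - y\<bar>"
      using Suc.IH[OF lens False] Suc.prems v w I_snoc_subset by blast
    moreover have "gap * len (Suc n) \<le> gap * len n"
      using gap_pos len_Suc_less[of n] by simp
    ultimately show ?thesis by linarith
  next
    case True
    have "len (Suc (Suc n)) \<le> len (Suc n) / B"
      using B_power_len_le[of 1 "Suc n"] B_gt_2 by (simp add: field_simps)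
    moreover have "gap * len (Suc n) = len (Suc n) - 2 * (len (Suc n) / B)"
      by (simp add: gap_def algebra_simps)
    ultimately show ?thesis
      using True Suc.prems v w lens by (cases a; cases b) (auto simp: I_eq left_end_snoc)
  qed
qed

text \<open>A common point has distance 0 from itself, which \<open>I_separated\<close> forbids for
  different words.\<close>

lemma I_unique:
  assumes "length v = length w" "x \<in> I v" "x \<in> I w"
  shows "v = w"
proof (rule ccontr)
  assume "v \<noteq> w"
  then obtain n where "length v = Suc n" using assms(1) by (cases v) auto
  then have "gap * len n \<le> 0"
    using I_separated[of v n w x x] assms \<open>v \<noteq> w\<close> by simp
  then show False using gap_pos len_pos[of n] by (simp add: mult_le_0_iff)
qed

section \<open>Points of the Cantor set and their codes\<close>

lemma X_iff: "x \<in> X \<longleftrightarrow> (\<forall>n. \<exists>w. length w = n \<and> x \<in> I w)"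
proof
  assume x: "x \<in> X"
  then have *: "\<exists>w. length w = n \<and> x \<in> I w" if "1 \<le> n" for n
    using that by (auto simp: cantorX_def)
  then obtain w where "length w = 1" "x \<in> I w" by blast
  \<comment> \<open>The definition of \<open>cantorX\<close> starts at level 1; level 0 is added
    here.\<close>
  then have "x \<in> I []" using I_take_subset[of w 0] by auto
  then show "\<forall>n. \<exists>w. length w = n \<and> x \<in> I w"
    using * by (metis length_0_conv less_one not_le)
qed (auto simp: cantorX_def)

text \<open>The choice is unique when \<open>x \<in> X\<close>, by \<open>I_unique\<close>; for
  other \<open>x\<close> it may be arbitrary.\<close>

definition code :: "real \<Rightarrow> nat \<Rightarrow> bool list" where
  "code x n = (SOME w. length w = n \<and> x \<in> I w)"

lemma code:
  assumes "x \<in> X"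
  shows length_code: "length (code x n) = n" and in_I_code: "x \<in> I (code x n)"
  using assms someI_ex[of "\<lambda>w. length w = n \<and> x \<in> I w"] by (auto simp: X_iff code_def)

lemma code_eqI: "x \<in> X \<Longrightarrow> x \<in> I w \<Longrightarrow> code x (length w) = w"
  by (rule I_unique[of _ _ x]) (auto simp: code)

lemma code_Suc:
  assumes "x \<in> X"
  obtains b where "code x (Suc n) = code x n @ [b]"
proof -
  have "length (code x (Suc n)) = Suc n" by (simp add: code assms)
  then obtain v b where vb: "code x (Suc n) = v @ [b]" by (cases "code x (Suc n)" rule: rev_cases) auto
  then have "x \<in> I v" using in_I_code[OF assms, of "Suc n"] I_snoc_subset[of v b] by auto
  moreover have "length v = n" using vb length_code[OF assms, of "Suc n"] by simp
  ultimately have "v = code x n" using code_eqI[of x v] assms by simp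
  with vb that show ?thesis by simp
qed

text \<open>\<open>Suc n\<close> is the least level whose length is at most \<open>r\<close>; that
  level is positive because \<open>len 0 = 1\<close> exceeds \<open>r\<close>.\<close>

lemma len_bracket:
  assumes "0 < r" "r < 1"
  obtains n where "len (Suc n) \<le> r" "r < len n"
proof -
  have "\<exists>n. len n \<le> r"
    using order_tendstoD(2)[OF len_tendsto_0 assms(1)]
    by (auto simp: eventually_sequentially intro: less_imp_le)
  define m where "m = (LEAST n. len n \<le> r)"
  have m: "len m \<le> r" "\<And>k. k < m \<Longrightarrow> r < len k"
    using \<open>\<exists>n. len n \<le> r\<close> not_less_Least[where P = "\<lambda>n. len n \<le> r"]
    by (auto simp: m_def intro: LeastI_ex simp flip: not_le)
  have "m \<noteq> 0" using m(1) assms by (metis len_0 not_le)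
  then obtain n where "m = Suc n" by (cases m) auto
  then show ?thesis using m that[of n] by auto
qed

definition level :: "nat \<Rightarrow> real set" where
  "level n = (\<Union>w\<in>{w. length w = n}. I w)"

lemma closed_level: "closed (level n)"
  unfolding level_def using finite_words closed_I by (intro closed_UN) auto

lemma X_eq_level: "X = (\<Inter>n. level n)"
  by (auto simp: X_iff level_def)

lemma closed_X: "closed X"
  unfolding X_eq_level using closed_level by (intro closed_INT) auto

text \<open>By \<open>I_separated\<close>, any other cylinder of level \<open>Suc n\<close> is at
  distance at least \<open>gap * len n\<close> from \<open>x\<close>, out of reach of the
  ball.\<close>

lemma cball_level_subset:
  assumes "length w = Suc n" "x \<in> I w" "r < gap * len n"
  shows "cball x r \<inter> level (Suc n) \<subseteq> I w"
proof
  fix y assume y: "y \<in> cball x r \<inter> level (Suc n)"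
  then obtain v where v: "length v = Suc n" "y \<in> I v" by (auto simp: level_def)
  have "\<bar>x - y\<bar> < gap * len n" using y assms by (simp add: dist_real_def)
  then have "v = w" using I_separated[of w n v x y] assms v by force
  with v show "y \<in> I w" by simp
qed

lemma I_subset_cball:
  assumes "x \<in> I w" "len (length w) \<le> r"
  shows "I w \<subseteq> cball x r"
  using assms by (auto simp: I_eq dist_real_def)

end

subsection \<open>Averages along the blocks and masses of balls\<close>

context cantor_scheme
begin

section \<open>Logarithms of lengths as sums over the levels\<close>

definition log_len :: "nat \<Rightarrow> real" where
  "log_len n = - ln (len n)"

lemma len_eq_exp: "len n = exp (- log_len n)"
  by (simp add: log_len_def len_pos)

lemma ln_ratio_pos: "0 < ln B" "0 < ln A" "ln B < ln A"
  using B_gt_2 A_gt_B by auto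

lemma log_len_0 [simp]: "log_len 0 = 0"
  by (simp add: log_len_def)

lemma log_len_Suc: "log_len (Suc n) = log_len n + ln (ratio A B N (Suc n))"
  using ratio_gt_2[of "Suc n"] len_pos[of n] by (simp add: log_len_def len_Suc ln_div)

lemma log_len_eq_sum: "log_len n = (\<Sum>k=1..n. if typeA N k then ln A else ln B)"
  by (induction n) (auto simp: log_len_Suc ratio_def)

lemma log_len_Suc_le: "log_len (Suc n) \<le> log_len n + ln A"
  using ln_ratio_pos by (simp add: log_len_Suc ratio_def)

lemma log_len_ge: "real n * ln B \<le> log_len n"
  using ln_ratio_pos by (induction n) (auto simp: log_len_Suc ratio_def algebra_simps)

lemma log_len_le: "log_len n \<le> real n * ln A"
  using ln_ratio_pos by (induction n) (auto simp: log_len_Suc ratio_def algebra_simps)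

text \<open>Consecutive blocks do not overlap, so the block containing \<open>k\<close> is unique
  and its parity decides the type.\<close>

lemma typeA_iff_even:
  assumes "N j < k" "k \<le> N (Suc j)"
  shows "typeA N k \<longleftrightarrow> even j"
proof
  assume "typeA N k"
  then obtain i where i: "N (2*i) < k" "k \<le> N (2*i+1)" by (auto simp: typeA_def)
  have "N j < N (2*i+1)" "N (2*i) < N (Suc j)" using assms i by auto
  then have "j < 2*i+1" "2*i < Suc j" using mono_N by (auto simp: strict_mono_less)
  then have "j = 2*i" by simp
  then show "even j" by simp
qed (use assms in \<open>auto simp: typeA_def elim!: evenE\<close>)

lemma N_ge: "j \<le> N j"
  using mono_N by (rule strict_mono_imp_increasing)

text \<open>Only the levels up to \<open>N (j i)\<close> contribute to the deviation from
  \<open>c\<close>, each at most \<open>D\<close>, and their share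
  \<open>N (j i) / N (Suc (j i))\<close> of all levels tends to 0.\<close>

lemma block_average_tendsto:
  fixes f :: "nat \<Rightarrow> real"
  assumes "strict_mono j"
    and block: "\<And>i k. N (j i) < k \<Longrightarrow> k \<le> N (Suc (j i)) \<Longrightarrow> f k = c"
    and bound: "\<And>k. \<bar>f k - c\<bar> \<le> D"
  shows "(\<lambda>i. (\<Sum>k=1..N (Suc (j i)). f k) / real (N (Suc (j i)))) \<longlonglongrightarrow> c"
proof -
  have "(\<lambda>i. inverse (real (N (Suc i)) / real (N i))) \<longlonglongrightarrow> 0"
    using N_ratio by (rule tendsto_inverse_0_at_top)
  then have "(\<lambda>i. real (N i) / real (N (Suc i))) \<longlonglongrightarrow> 0" by simp
  from LIMSEQ_subseq_LIMSEQ[OF this assms(1)]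
  have "(\<lambda>i. real (N (j i)) / real (N (Suc (j i)))) \<longlonglongrightarrow> 0" by (simp add: o_def)
  then have lim: "(\<lambda>i. D * (real (N (j i)) / real (N (Suc (j i))))) \<longlonglongrightarrow> 0"
    by (rule tendsto_mult_right_zero)
  have "\<bar>(\<Sum>k=1..N (Suc (j i)). f k) / real (N (Suc (j i))) - c\<bar>
      \<le> D * (real (N (j i)) / real (N (Suc (j i))))" for i
  proof -
    let ?n = "N (Suc (j i))" and ?m = "N (j i)"
    have mn: "?m < ?n" using mono_N by (simp add: strict_mono_less)
    have "(\<Sum>k=1..?n. f k) - c * real ?n = (\<Sum>k=1..?n. f k - c)"
      by (simp add: sum_subtractf mult.commute)
    also have "\<dots> = (\<Sum>k=1..?m. f k - c)"
      using mn block[of i] by (intro sum.mono_neutral_right) auto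
    finally have eq: "(\<Sum>k=1..?n. f k) - c * real ?n = (\<Sum>k=1..?m. f k - c)" .
    have "\<bar>\<Sum>k=1..?m. f k - c\<bar> \<le> (\<Sum>k=1..?m. \<bar>f k - c\<bar>)" by (rule sum_abs)
    also have "\<dots> \<le> real ?m * D"
      using sum_bounded_above[of "{1..?m}" "\<lambda>k. \<bar>f k - c\<bar>" D] bound by simp
    finally have "\<bar>(\<Sum>k=1..?n. f k) - c * real ?n\<bar> \<le> real ?m * D" using eq by simp
    moreover have "(\<Sum>k=1..?n. f k) / real ?n - c = ((\<Sum>k=1..?n. f k) - c * real ?n) / real ?n"
      using mn by (simp add: field_simps)
    ultimately show ?thesis
      using mn by (simp add: abs_divide divide_simps mult.commute)
  qed
  then have "(\<lambda>i. (\<Sum>k=1..N (Suc (j i)). f k) / real (N (Suc (j i))) - c) \<longlonglongrightarrow> 0"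
    by (intro Lim_null_comparison[OF _ lim]) auto
  then show ?thesis by (simp add: LIM_zero_iff)
qed

lemma average_tendsto_typeA:
  fixes a b :: real
  shows "(\<lambda>i. (\<Sum>k=1..N (Suc (2*i)). if typeA N k then a else b) / real (N (Suc (2*i)))) \<longlonglongrightarrow> a"
  by (rule block_average_tendsto[where D = "\<bar>b - a\<bar>"])
     (auto simp: strict_mono_def typeA_iff_even)

lemma average_tendsto_typeB:
  fixes a b :: real
  shows "(\<lambda>i. (\<Sum>k=1..N (Suc (Suc (2*i))). if typeA N k then a else b) / real (N (Suc (Suc (2*i))))) \<longlonglongrightarrow> b"
  by (rule block_average_tendsto[where D = "\<bar>a - b\<bar>" and j = "\<lambda>i. Suc (2*i)"])
     (auto simp: strict_mono_def typeA_iff_even)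

lemma filterlim_N_odd: "filterlim (\<lambda>i. N (Suc (2*i))) at_top sequentially"
  and filterlim_N_even: "filterlim (\<lambda>i. N (Suc (Suc (2*i)))) at_top sequentially"
  using mono_N by (auto intro!: filterlim_subseq simp: strict_mono_def)

text \<open>Term by term comparison: both \<open>a / ln A\<close> and \<open>b / ln B\<close> are at
  least \<open>s\<close>. The bound holds at every level, not only at the ends of blocks.\<close>

lemma block_sum_ge:
  assumes "s * ln A \<le> a" "s * ln B \<le> b"
  shows "s * log_len n \<le> (\<Sum>k=1..n. if typeA N k then a else b)"
  unfolding log_len_eq_sum sum_distrib_left using assms by (intro sum_mono) auto

lemma block_sum_le:
  assumes "a \<le> s * ln A" "b \<le> s * ln B"
  shows "(\<Sum>k=1..n. if typeA N k then a else b) \<le> s * log_len n"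
  unfolding log_len_eq_sum sum_distrib_left using assms by (intro sum_mono) auto

text \<open>By \<open>len_bracket\<close> the intervals from \<open>len (Suc n)\<close> to
  \<open>len n\<close> exhaust the radii below 1, and small radii force large \<open>n\<close>; so
  an estimate for each level becomes one for all small radii.\<close>

lemma eventually_at_right_len:
  assumes "\<forall>\<^sub>F n in sequentially. \<forall>r. len (Suc n) \<le> r \<longrightarrow> r < len n \<longrightarrow> P r"
  shows "\<forall>\<^sub>F r in at_right 0. P r"
proof -
  obtain m where m: "\<And>n r. m \<le> n \<Longrightarrow> len (Suc n) \<le> r \<Longrightarrow> r < len n \<Longrightarrow> P r"
    using assms by (auto simp: eventually_sequentially)
  have "P r" if r: "0 < r" "r < len m" for r
  proof -
    have "r < 1" using len_antimono[of 0 m] r by simp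
    then obtain n where n: "len (Suc n) \<le> r" "r < len n" using len_bracket r by blast
    have "m \<le> n"
    proof (rule ccontr)
      assume "\<not> m \<le> n"
      then have "len m \<le> len (Suc n)" by (intro len_antimono) simp
      then show False using n r by simp
    qed
    then show ?thesis using m n by blast
  qed
  then show ?thesis
    using len_pos[of m] by (auto simp: eventually_at_right_field)
qed

text \<open>For estimates needed only along some radii, the lengths themselves serve as
  radii.\<close>

lemma frequently_at_right_len:
  assumes "\<exists>\<^sub>F n in sequentially. P (len n)"
  shows "\<exists>\<^sub>F r in at_right 0. P r"
proof -
  have "filterlim len (at_right 0) sequentially"
    using len_tendsto_0 len_pos by (intro tendsto_imp_filterlim_at_right) auto
  then show ?thesis
    using assms eventually_compose_filterlim unfolding frequently_def by blast
qed

end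

section \<open>Measures with prescribed masses of cylinders\<close>

locale cantor_measure = cantor_scheme +
  fixes p q :: real and \<mu> :: "real measure"
  assumes p_pos: "0 < p" and p_le: "p \<le> 1/2" and q_pos: "0 < q" and q_le: "q \<le> 1/2"
    and sets_mu [measurable_cong]: "sets \<mu> = sets borel"
    and mu_prob: "prob_space \<mu>"
    and mu_cyl: "\<And>w. measure \<mu> (cyl A B N w) = weight p q N w"
begin

sublocale prob_space \<mu>
  by (rule mu_prob)

abbreviation "wt \<equiv> weight p q N"

definition letter_prob :: "nat \<Rightarrow> bool \<Rightarrow> real" where
  "letter_prob k b = (if b then 1 - rho p q N k else rho p q N k)"

lemma letter_prob_bounds: "min p q \<le> letter_prob k b" "letter_prob k b < 1"
  using p_pos p_le q_pos q_le by (auto simp: letter_prob_def rho_def)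

lemma letter_prob_pos: "0 < letter_prob k b"
  using p_pos p_le q_pos q_le by (auto simp: letter_prob_def rho_def)

lemma letter_prob_sum: "letter_prob k False + letter_prob k True = 1"
  by (simp add: letter_prob_def)

lemma wt_Nil [simp]: "wt [] = 1"
  by (simp add: weight_def)

lemma wt_snoc: "wt (w @ [b]) = letter_prob (Suc (length w)) b * wt w"
  by (simp add: weight_def letter_prob_def)

lemma wt_pos: "0 < wt w"
  by (induction w rule: rev_induct) (auto simp: wt_snoc letter_prob_pos)

text \<open>Integrates out the last letter; this recursion drives the moment computations.\<close>

lemma sum_wt_Suc:
  "(\<Sum>w | length w = Suc n. wt w * f w) =
   (\<Sum>w | length w = n. wt w * (letter_prob (Suc n) False * f (w @ [False]) + letter_prob (Suc n) True * f (w @ [True])))"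
  unfolding sum_words_Suc by (intro sum.cong) (auto simp: wt_snoc algebra_simps)

lemma sum_wt: "(\<Sum>w | length w = n. wt w) = 1"
proof (induction n)
  case (Suc n)
  then show ?case using sum_wt_Suc[of "\<lambda>_. 1" n] by (simp add: letter_prob_sum)
qed simp

lemma I_sets [measurable]: "I w \<in> sets \<mu>"
  using closed_I by (simp add: sets_mu borel_closed)

lemma measure_words:
  assumes "V \<subseteq> {w. length w = n}"
  shows "measure \<mu> (\<Union>w\<in>V. I w) = (\<Sum>w\<in>V. wt w)"
proof -
  have "finite V" using assms finite_words finite_subset by blast
  moreover have "disjoint_family_on I V"
    unfolding disjoint_family_on_def using I_unique assms by blast
  ultimately have "measure \<mu> (\<Union>w\<in>V. I w) = (\<Sum>w\<in>V. measure \<mu> (I w))"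
    using I_sets by (intro measure_finite_Union) (auto simp: emeasure_eq_measure)
  then show ?thesis by (simp add: mu_cyl)
qed

text \<open>The weights of one level sum to 1. That \<mu> is concentrated on \<open>X\<close> is
  derived from this, not assumed.\<close>

lemma AE_level: "AE x in \<mu>. x \<in> level n"
proof -
  have "measure \<mu> (level n) = 1"
    unfolding level_def using measure_words[of "{w. length w = n}" n] sum_wt by simp
  moreover have "level n \<in> sets \<mu>" using closed_level by (simp add: sets_mu borel_closed)
  ultimately show ?thesis using prob_eq_1 by blast
qed

lemma AE_X: "AE x in \<mu>. x \<in> X"
  unfolding X_eq_level using AE_level by (simp add: AE_all_countable)

lemma cball_sets [measurable]: "cball x r \<in> sets \<mu>"
  by (simp add: sets_mu)

section \<open>Masses of balls and weights of cylinders\<close>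

lemma measure_cball_ge:
  assumes "x \<in> X" "len n \<le> r"
  shows "wt (code x n) \<le> measure \<mu> (cball x r)"
proof -
  have "measure \<mu> (I (code x n)) \<le> measure \<mu> (cball x r)"
    using assms by (intro finite_measure_mono I_subset_cball) (auto simp: code)
  then show ?thesis by (simp add: mu_cyl)
qed

text \<open>The ball lies in the cylinder only after intersection with \<open>level (Suc n)\<close>;
  that level has full mass, so the inclusion holds almost everywhere.\<close>

lemma measure_cball_le:
  assumes "x \<in> X" "r < gap * len n"
  shows "measure \<mu> (cball x r) \<le> wt (code x (Suc n))"
proof -
  have "AE y in \<mu>. y \<in> cball x r \<longrightarrow> y \<in> I (code x (Suc n))"
    using AE_level[of "Suc n"]
  proof eventually_elim
    case (elim y)
    then show ?case using cball_level_subset[of "code x (Suc n)" n x r] code assms by blast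
  qed
  then have "measure \<mu> (cball x r) \<le> measure \<mu> (I (code x (Suc n)))"
    by (intro finite_measure_mono_AE) auto
  then show ?thesis by (simp add: mu_cyl)
qed

text \<open>Additive over the letters of the code, like \<open>log_len\<close>; at points of
  \<open>X\<close> the local dimensions are the lower and upper limits of
  \<open>info x n / log_len n\<close>.\<close>

definition info :: "real \<Rightarrow> nat \<Rightarrow> real" where
  "info x n = - ln (wt (code x n))"

text \<open>No letter is less likely than \<open>min p q\<close>, because \<open>p\<close> and
  \<open>q\<close> are at most 1/2; so no single letter carries more information than this.\<close>

definition max_info :: real where
  "max_info = - ln (min p q)"

lemma max_info_pos: "0 < max_info"
  using p_pos p_le q_pos q_le by (auto simp: max_info_def min_def)

lemma info_Suc:
  assumes "x \<in> X"
  obtains b where "code x (Suc n) = code x n @ [b]" "info x (Suc n) = info x n - ln (letter_prob (Suc n) b)"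
proof -
  obtain b where b: "code x (Suc n) = code x n @ [b]" using code_Suc assms by blast
  have "info x (Suc n) = info x n - ln (letter_prob (Suc n) b)"
    using wt_pos[of "code x n"] letter_prob_pos[of "Suc n" b]
    by (simp add: info_def b wt_snoc code assms ln_mult)
  with b that show ?thesis by blast
qed

lemma info_Suc_le:
  assumes "x \<in> X"
  shows "info x (Suc n) \<le> info x n + max_info"
proof -
  obtain b where b: "info x (Suc n) = info x n - ln (letter_prob (Suc n) b)"
    using info_Suc assms by blast
  have "ln (min p q) \<le> ln (letter_prob (Suc n) b)"
    using letter_prob_bounds[of "Suc n" b] p_pos q_pos by (subst ln_le_cancel_iff) (auto simp: letter_prob_pos)
  with b show ?thesis by (simp add: max_info_def)
qed

lemma info_add_le: "x \<in> X \<Longrightarrow> info x (n + k) \<le> info x n + real k * max_info"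
proof (induction k)
  case (Suc k)
  then show ?case using info_Suc_le[of x "n + k"] by (simp add: algebra_simps)
qed simp

text \<open>A ball of radius less than len (n + shift) cannot leave its cylinder of length n + 1.\<close>
definition shift :: nat where
  "shift = (SOME k. 1 \<le> gap * B ^ k)"

lemma shift: "1 \<le> gap * B ^ shift"
proof -
  obtain k where "1 / gap < B ^ k" using real_arch_pow[of B "1 / gap"] B_gt_2 by auto
  then have "1 \<le> gap * B ^ k" using gap_pos by (simp add: field_simps)
  then show ?thesis unfolding shift_def by (rule someI)
qed

lemma measure_cball_le_shift:
  assumes "x \<in> X" "r < len (n + shift)"
  shows "measure \<mu> (cball x r) \<le> wt (code x (Suc n))"
proof (rule measure_cball_le[OF assms(1)])
  have "len (n + shift) \<le> gap * B ^ shift * len (n + shift)"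
    using shift len_pos[of "n + shift"] by simp
  also have "\<dots> \<le> gap * len n"
    using B_power_len_le[of shift n] gap_pos by (simp add: mult.assoc)
  finally show "r < gap * len n" using assms by simp
qed

text \<open>The mass of the ball is at most that of the cylinder of level
  \<open>Suc (n - shift)\<close>. Passing up from level \<open>Suc n\<close> loses at most
  \<open>shift * max_info\<close> of information, which the hypothesis on \<open>t\<close> keeps in
  reserve.\<close>

lemma le_loc_ratio:
  assumes x: "x \<in> X" and r: "len (Suc n) \<le> r" "r < len n" and n: "shift \<le> n"
    and t: "0 \<le> t" "t * log_len (Suc n) + real shift * max_info \<le> info x (Suc n)"
  shows "ereal t \<le> loc_ratio \<mu> x r"
proof -
  define m where "m = measure \<mu> (cball x r)"
  have pos: "0 < m" using measure_cball_ge[OF x r(1)] wt_pos unfolding m_def by (rule less_le_trans[rotated])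
  have "m \<le> wt (code x (Suc (n - shift)))"
    using measure_cball_le_shift[OF x, of r "n - shift"] r n by (simp add: m_def)
  then have "info x (Suc (n - shift)) \<le> - ln m"
    using pos by (simp add: info_def)
  moreover have "info x (Suc n) \<le> info x (Suc (n - shift)) + real shift * max_info"
    using info_add_le[OF x, of "Suc (n - shift)" shift] n by simp
  ultimately have 1: "t * log_len (Suc n) \<le> - ln m" using t by simp
  have r0: "0 < r" using r len_pos[of "Suc n"] by simp
  have "r < 1" using r len_antimono[of 0 n] by simp
  have "- ln r \<le> log_len (Suc n)" using r r0 len_pos[of "Suc n"] by (simp add: log_len_def)
  then have "t * (- ln r) \<le> t * log_len (Suc n)" using t(1) by (rule mult_left_mono)
  with 1 have "t * (- ln r) \<le> - ln m" by simp
  moreover have "ln r < 0" using r0 \<open>r < 1\<close> by simp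
  ultimately have "t \<le> ln m / ln r" by (simp add: neg_le_divide_eq)
  then show ?thesis using pos by (simp add: loc_ratio_def m_def)
qed

text \<open>The ball contains the cylinder of level \<open>Suc n\<close>, while \<open>r\<close> is
  only known to lie below \<open>len n\<close>; one level changes \<open>log_len\<close> by at most
  \<open>ln A\<close>, whence the correction.\<close>

lemma loc_ratio_le:
  assumes x: "x \<in> X" and r: "len (Suc n) \<le> r" "r < len n"
    and t: "0 \<le> t" "info x (Suc n) \<le> t * (log_len (Suc n) - ln A)"
  shows "loc_ratio \<mu> x r \<le> ereal t"
proof -
  define m where "m = measure \<mu> (cball x r)"
  have le: "wt (code x (Suc n)) \<le> m" using measure_cball_ge[OF x r(1)] by (simp add: m_def)
  then have pos: "0 < m" using wt_pos by (rule less_le_trans[rotated])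
  have 1: "- ln m \<le> info x (Suc n)" using le wt_pos pos by (simp add: info_def)
  have r0: "0 < r" using r len_pos[of "Suc n"] by simp
  have "r < 1" using r len_antimono[of 0 n] by simp
  have "ln r \<le> ln (len n)" using r r0 len_pos[of n] by simp
  then have "log_len (Suc n) - ln A \<le> - ln r" using log_len_Suc_le[of n] by (simp add: log_len_def)
  then have "t * (log_len (Suc n) - ln A) \<le> t * (- ln r)" using t(1) by (rule mult_left_mono)
  with 1 t have "- ln m \<le> t * (- ln r)" by simp
  moreover have "ln r < 0" using r0 \<open>r < 1\<close> by simp
  ultimately have "ln m / ln r \<le> t" by (simp add: neg_divide_le_eq)
  then show ?thesis using pos by (simp add: loc_ratio_def m_def)
qed

end

subsection \<open>Local dimensions\<close>

context cantor_measure
begin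

section \<open>Local dimensions from the growth of information along the levels\<close>

lemma lower_local_dim_geI:
  assumes x: "x \<in> X" and s: "0 < s"
    and ev: "\<And>t. 0 \<le> t \<Longrightarrow> t < s \<Longrightarrow> \<forall>\<^sub>F n in sequentially. t * log_len n + real shift * max_info \<le> info x n"
  shows "ereal s \<le> lower_local_dim \<mu> x"
  unfolding lower_local_dim_def
proof (rule ereal_leI_real)
  fix t :: real assume "t < s"
  \<comment> \<open>\<open>le_loc_ratio\<close> needs a nonnegative threshold; raising
    \<open>t\<close> only strengthens the claim, and \<open>t'\<close> stays below \<open>s\<close>
    because \<open>s\<close> is positive.\<close>
  define t' where "t' = max t 0"
  have t': "0 \<le> t'" "t' < s" "t \<le> t'" using \<open>t < s\<close> s by (auto simp: t'_def)
  have "\<forall>\<^sub>F n in sequentially. t' * log_len (Suc n) + real shift * max_info \<le> info x (Suc n)"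
    using ev[OF t'(1,2)] filterlim_Suc by (rule eventually_compose_filterlim)
  then have "\<forall>\<^sub>F n in sequentially. \<forall>r. len (Suc n) \<le> r \<longrightarrow> r < len n \<longrightarrow> ereal t' \<le> loc_ratio \<mu> x r"
    using eventually_ge_at_top[of shift]
    by eventually_elim (use x t' le_loc_ratio in blast)
  then have "\<forall>\<^sub>F r in at_right 0. ereal t' \<le> loc_ratio \<mu> x r"
    by (rule eventually_at_right_len)
  then have "ereal t' \<le> Liminf (at_right 0) (loc_ratio \<mu> x)"
    by (rule Liminf_bounded)
  then show "ereal t \<le> Liminf (at_right 0) (loc_ratio \<mu> x)"
    using t' by (meson ereal_less_eq(3) order_trans)
qed

lemma upper_local_dim_leI:
  assumes x: "x \<in> X" and s: "0 \<le> s"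
    and ev: "\<And>t. s < t \<Longrightarrow> \<forall>\<^sub>F n in sequentially. info x n \<le> t * (log_len n - ln A)"
  shows "upper_local_dim \<mu> x \<le> ereal s"
  unfolding upper_local_dim_def
proof (rule ereal_le_epsilon2)
  fix e :: real assume "0 < e"
  then have t: "0 \<le> s + e" "s < s + e" using s by auto
  have "\<forall>\<^sub>F n in sequentially. info x (Suc n) \<le> (s + e) * (log_len (Suc n) - ln A)"
    using ev[OF t(2)] filterlim_Suc by (rule eventually_compose_filterlim)
  then have "\<forall>\<^sub>F n in sequentially. \<forall>r. len (Suc n) \<le> r \<longrightarrow> r < len n \<longrightarrow> loc_ratio \<mu> x r \<le> ereal (s + e)"
    by eventually_elim (use x t loc_ratio_le in blast)
  then have "\<forall>\<^sub>F r in at_right 0. loc_ratio \<mu> x r \<le> ereal (s + e)"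
    by (rule eventually_at_right_len)
  then have "Limsup (at_right 0) (loc_ratio \<mu> x) \<le> ereal (s + e)"
    by (rule Limsup_bounded)
  then show "Limsup (at_right 0) (loc_ratio \<mu> x) \<le> ereal s + ereal e" by simp
qed

lemma lower_local_dim_leI:
  assumes x: "x \<in> X" and s: "0 \<le> s"
    and fr: "\<And>t. s < t \<Longrightarrow> \<exists>\<^sub>F n in sequentially. info x n \<le> t * (log_len n - ln A)"
  shows "lower_local_dim \<mu> x \<le> ereal s"
  unfolding lower_local_dim_def
proof (rule ereal_le_epsilon2)
  fix e :: real assume "0 < e"
  then have t: "0 \<le> s + e" "s < s + e" using s by auto
  have "\<exists>\<^sub>F n in sequentially. loc_ratio \<mu> x (len n) \<le> ereal (s + e)"
  proof (rule frequently_rev_mp[OF fr[OF t(2)]])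
    show "\<forall>\<^sub>F n in sequentially. info x n \<le> (s + e) * (log_len n - ln A) \<longrightarrow> loc_ratio \<mu> x (len n) \<le> ereal (s + e)"
      using eventually_ge_at_top[of "Suc 0"]
    proof eventually_elim
      case (elim n)
      \<comment> \<open>The radius \<open>len n\<close> is the closed lower end of the bracket of
        level \<open>m\<close>, so the estimate is again one at level \<open>n\<close>.\<close>
      then obtain m where "n = Suc m" by (cases n) auto
      then show ?case using loc_ratio_le[OF x _ len_Suc_less t(1)] by blast
    qed
  qed
  then have fr': "\<exists>\<^sub>F r in at_right 0. loc_ratio \<mu> x r \<le> ereal (s + e)"
    by (rule frequently_at_right_len)
  have "Liminf (at_right 0) (loc_ratio \<mu> x) \<le> ereal (s + e)"
  proof (rule ccontr)
    assume "\<not> ?thesis"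
    then have "\<forall>\<^sub>F r in at_right 0. ereal (s + e) < loc_ratio \<mu> x r"
      by (intro less_LiminfD) simp
    then show False using fr' by (auto simp: frequently_def not_le)
  qed
  then show "Liminf (at_right 0) (loc_ratio \<mu> x) \<le> ereal s + ereal e" by simp
qed

lemma upper_local_dim_geI:
  assumes x: "x \<in> X" and s: "0 < s"
    and fr: "\<And>t. 0 \<le> t \<Longrightarrow> t < s \<Longrightarrow> \<exists>\<^sub>F n in sequentially. t * log_len n + real shift * max_info \<le> info x n"
  shows "ereal s \<le> upper_local_dim \<mu> x"
  unfolding upper_local_dim_def
proof (rule ereal_leI_real)
  fix t :: real assume "t < s"
  define t' where "t' = max t 0"
  have t': "0 \<le> t'" "t' < s" "t \<le> t'" using \<open>t < s\<close> s by (auto simp: t'_def)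
  have "\<exists>\<^sub>F n in sequentially. ereal t' \<le> loc_ratio \<mu> x (len n)"
  proof (rule frequently_rev_mp[OF fr[OF t'(1,2)]])
    show "\<forall>\<^sub>F n in sequentially. t' * log_len n + real shift * max_info \<le> info x n \<longrightarrow> ereal t' \<le> loc_ratio \<mu> x (len n)"
      using eventually_ge_at_top[of "Suc shift"]
    proof eventually_elim
      case (elim n)
      then obtain m where "n = Suc m" "shift \<le> m" by (cases n) auto
      then show ?case using le_loc_ratio[OF x _ len_Suc_less _ t'(1)] by blast
    qed
  qed
  then have fr': "\<exists>\<^sub>F r in at_right 0. ereal t' \<le> loc_ratio \<mu> x r"
    by (rule frequently_at_right_len)
  have "ereal t' \<le> Limsup (at_right 0) (loc_ratio \<mu> x)"
  proof (rule ccontr)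
    assume "\<not> ?thesis"
    then have "\<forall>\<^sub>F r in at_right 0. loc_ratio \<mu> x r < ereal t'"
      by (intro Limsup_lessD) simp
    then show False using fr' by (auto simp: frequently_def not_le)
  qed
  then show "ereal t \<le> Limsup (at_right 0) (loc_ratio \<mu> x)"
    using t' by (meson ereal_less_eq(3) order_trans)
qed

text \<open>The lower dimension is bounded at all levels by \<open>block_sum_ge\<close>; the upper
  one only at the ends of type B blocks, where the averages tend to \<open>b\<close> and
  \<open>ln B\<close>. General \<open>a\<close> and \<open>b\<close> cover both the extremal letters
  and the entropies.\<close>

lemma local_dim_ge:
  assumes x: "x \<in> X" and pos: "0 < a" "0 < b" and ab: "a / ln A \<le> b / ln B"
    and info: "\<And>e. 0 < e \<Longrightarrow> \<forall>\<^sub>F n in sequentially.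
       (\<Sum>k=1..n. if typeA N k then a else b) - e * real n \<le> info x n"
  shows "ereal (a / ln A) \<le> lower_local_dim \<mu> x" "ereal (b / ln B) \<le> upper_local_dim \<mu> x"
proof -
  let ?H = "\<lambda>n. \<Sum>k=1..n. if typeA N k then a else b"
  show "ereal (a / ln A) \<le> lower_local_dim \<mu> x"
  proof (rule lower_local_dim_geI[OF x])
    fix t assume t: "0 \<le> t" "t < a / ln A"
    \<comment> \<open>Since \<open>log_len n\<close> is at least \<open>real n * ln B\<close>, the
      slack in \<open>t\<close> is worth \<open>2 * e * real n\<close>: one half pays for the error
      in \<open>info\<close>, the other for the constant.\<close>
    define e where "e = (a / ln A - t) * ln B / 2"
    have "0 < e" using t ln_ratio_pos by (simp add: e_def)
    show "\<forall>\<^sub>F n in sequentially. t * log_len n + real shift * max_info \<le> info x n"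
      using info[OF \<open>0 < e\<close>] eventually_const_le[OF \<open>0 < e\<close>, of "real shift * max_info"]
    proof eventually_elim
      case (elim n)
      have "a / ln A * log_len n \<le> ?H n"
        using ab ln_ratio_pos by (intro block_sum_ge) (auto simp: field_simps)
      moreover have "(a / ln A - t) * (real n * ln B) \<le> (a / ln A - t) * log_len n"
        using log_len_ge t by (intro mult_left_mono) auto
      moreover have "(a / ln A - t) * (real n * ln B) = 2 * (e * real n)"
        by (simp add: e_def)
      ultimately show ?case using elim by (simp add: left_diff_distrib)
    qed
  qed (use pos ln_ratio_pos in auto)
  show "ereal (b / ln B) \<le> upper_local_dim \<mu> x"
  proof (rule upper_local_dim_geI[OF x])
    fix t assume t: "0 \<le> t" "t < b / ln B"
    \<comment> \<open>The limit below is \<open>4 * e\<close>, so the difference of averages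
      eventually exceeds \<open>2 * e\<close>, which is spent on the same two errors.\<close>
    define e where "e = (b - t * ln B) / 4"
    have "0 < e" using t ln_ratio_pos by (simp add: e_def field_simps)
    let ?g = "\<lambda>i. N (Suc (Suc (2*i)))"
    have "(\<lambda>i. ?H (?g i) / real (?g i) - t * (log_len (?g i) / real (?g i))) \<longlonglongrightarrow> b - t * ln B"
      unfolding log_len_eq_sum by (intro tendsto_intros average_tendsto_typeB)
    moreover have "2 * e < b - t * ln B" using \<open>0 < e\<close> by (simp add: e_def)
    ultimately have 1: "\<forall>\<^sub>F i in sequentially. 2 * e < ?H (?g i) / real (?g i) - t * (log_len (?g i) / real (?g i))"
      by (rule order_tendstoD)
    have 2: "\<forall>\<^sub>F i in sequentially. ?H (?g i) - e * real (?g i) \<le> info x (?g i)"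
      using info[OF \<open>0 < e\<close>] filterlim_N_even by (rule eventually_compose_filterlim)
    have 3: "\<forall>\<^sub>F i in sequentially. real shift * max_info \<le> e * real (?g i)"
      using eventually_const_le[OF \<open>0 < e\<close>] filterlim_N_even by (rule eventually_compose_filterlim)
    have "\<forall>\<^sub>F i in sequentially. t * log_len (?g i) + real shift * max_info \<le> info x (?g i)"
      using 1 2 3
    proof eventually_elim
      case (elim i)
      have "0 < real (?g i)" using N_ge[of "Suc (Suc (2*i))"] by simp
      then have "2 * e * real (?g i) < ?H (?g i) - t * log_len (?g i)"
        using elim(1) by (simp add: field_simps)
      then show ?case using elim by simp
    qed
    then show "\<exists>\<^sub>F n in sequentially. t * log_len n + real shift * max_info \<le> info x n"
      by (rule frequently_subseq[OF filterlim_N_even])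
  qed (use pos ln_ratio_pos in auto)
qed

text \<open>Mirror image of \<open>local_dim_ge\<close>: the upper dimension is bounded at all
  levels, the lower one at the ends of type A blocks. The constant to absorb is now
  \<open>t * ln A\<close> from \<open>loc_ratio_le\<close>.\<close>

lemma local_dim_le:
  assumes x: "x \<in> X" and pos: "0 < a" "0 < b" and ab: "a / ln A \<le> b / ln B"
    and info: "\<And>e. 0 < e \<Longrightarrow> \<forall>\<^sub>F n in sequentially.
       info x n \<le> (\<Sum>k=1..n. if typeA N k then a else b) + e * real n"
  shows "lower_local_dim \<mu> x \<le> ereal (a / ln A)" "upper_local_dim \<mu> x \<le> ereal (b / ln B)"
proof -
  let ?H = "\<lambda>n. \<Sum>k=1..n. if typeA N k then a else b"
  show "upper_local_dim \<mu> x \<le> ereal (b / ln B)"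
  proof (rule upper_local_dim_leI[OF x])
    fix t assume t: "b / ln B < t"
    define e where "e = (t - b / ln B) * ln B / 2"
    have "0 < e" using t ln_ratio_pos by (simp add: e_def)
    show "\<forall>\<^sub>F n in sequentially. info x n \<le> t * (log_len n - ln A)"
      using info[OF \<open>0 < e\<close>] eventually_const_le[OF \<open>0 < e\<close>, of "t * ln A"]
    proof eventually_elim
      case (elim n)
      have "?H n \<le> b / ln B * log_len n"
        using ab ln_ratio_pos by (intro block_sum_le) (auto simp: field_simps)
      moreover have "(t - b / ln B) * (real n * ln B) \<le> (t - b / ln B) * log_len n"
        using log_len_ge t by (intro mult_left_mono) auto
      moreover have "(t - b / ln B) * (real n * ln B) = 2 * (e * real n)"
        by (simp add: e_def)
      ultimately show ?case using elim by (simp add: left_diff_distrib right_diff_distrib)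
    qed
  qed (use pos ln_ratio_pos in auto)
  show "lower_local_dim \<mu> x \<le> ereal (a / ln A)"
  proof (rule lower_local_dim_leI[OF x])
    fix t assume t: "a / ln A < t"
    define e where "e = (t * ln A - a) / 4"
    have "0 < e" using t ln_ratio_pos by (simp add: e_def field_simps)
    let ?g = "\<lambda>i. N (Suc (2*i))"
    have "(\<lambda>i. t * (log_len (?g i) / real (?g i)) - ?H (?g i) / real (?g i)) \<longlonglongrightarrow> t * ln A - a"
      unfolding log_len_eq_sum by (intro tendsto_intros average_tendsto_typeA)
    moreover have "2 * e < t * ln A - a" using \<open>0 < e\<close> by (simp add: e_def)
    ultimately have 1: "\<forall>\<^sub>F i in sequentially. 2 * e < t * (log_len (?g i) / real (?g i)) - ?H (?g i) / real (?g i)"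
      by (rule order_tendstoD)
    have 2: "\<forall>\<^sub>F i in sequentially. info x (?g i) \<le> ?H (?g i) + e * real (?g i)"
      using info[OF \<open>0 < e\<close>] filterlim_N_odd by (rule eventually_compose_filterlim)
    have 3: "\<forall>\<^sub>F i in sequentially. t * ln A \<le> e * real (?g i)"
      using eventually_const_le[OF \<open>0 < e\<close>] filterlim_N_odd by (rule eventually_compose_filterlim)
    have "\<forall>\<^sub>F i in sequentially. info x (?g i) \<le> t * (log_len (?g i) - ln A)"
      using 1 2 3
    proof eventually_elim
      case (elim i)
      have "0 < real (?g i)" using N_ge[of "Suc (2*i)"] by simp
      then have "2 * e * real (?g i) < t * log_len (?g i) - ?H (?g i)"
        using elim(1) by (simp add: field_simps)
      then show ?case using elim by (simp add: right_diff_distrib)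
    qed
    then show "\<exists>\<^sub>F n in sequentially. info x n \<le> t * (log_len n - ln A)"
      by (rule frequently_subseq[OF filterlim_N_odd])
  qed (use pos ln_ratio_pos in auto)
qed

section \<open>Bounds at every point from the extremal letters\<close>

lemma ln_bounds: "0 < - ln (1 - p)" "0 < - ln (1 - q)" "- ln (1 - p) \<le> - ln p" "- ln (1 - q) \<le> - ln q"
  "0 < - ln p" "0 < - ln q"
  using p_pos p_le q_pos q_le by auto

lemma letter_info_bounds:
  "(if typeA N k then - ln (1 - p) else - ln (1 - q)) \<le> - ln (letter_prob k b)"
  "- ln (letter_prob k b) \<le> (if typeA N k then - ln p else - ln q)"
  using ln_bounds by (auto simp: letter_prob_def rho_def)

lemma info_ge_sum: "x \<in> X \<Longrightarrow> (\<Sum>k=1..n. if typeA N k then - ln (1 - p) else - ln (1 - q)) \<le> info x n"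
proof (induction n)
  case 0
  then show ?case using length_code[of x 0] by (simp add: info_def)
next
  case (Suc n)
  obtain b where "info x (Suc n) = info x n - ln (letter_prob (Suc n) b)"
    using info_Suc Suc.prems by blast
  then show ?case using Suc letter_info_bounds(1)[of "Suc n" b] by simp
qed

lemma info_le_sum: "x \<in> X \<Longrightarrow> info x n \<le> (\<Sum>k=1..n. if typeA N k then - ln p else - ln q)"
proof (induction n)
  case 0
  then show ?case using length_code[of x 0] by (simp add: info_def)
next
  case (Suc n)
  obtain b where "info x (Suc n) = info x n - ln (letter_prob (Suc n) b)"
    using info_Suc Suc.prems by blast
  then show ?case using Suc letter_info_bounds(2)[of "Suc n" b] by simp
qed

lemma local_dim_bounds:
  assumes "x \<in> X" and dim: "- ln p / ln A < - ln (1 - q) / ln B"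
  shows "ereal (- ln (1 - p) / ln A) \<le> lower_local_dim \<mu> x"
    "lower_local_dim \<mu> x \<le> ereal (- ln p / ln A)"
    "ereal (- ln (1 - q) / ln B) \<le> upper_local_dim \<mu> x"
    "upper_local_dim \<mu> x \<le> ereal (- ln q / ln B)"
proof -
  \<comment> \<open>With \<open>dim\<close> in the middle these form one chain of four quotients,
    from which both comparisons of a type A with a type B quotient follow.\<close>
  have "- ln (1 - p) / ln A \<le> - ln p / ln A" "- ln (1 - q) / ln B \<le> - ln q / ln B"
    using ln_bounds ln_ratio_pos by (auto intro!: divide_right_mono)
  then have ab: "- ln (1 - p) / ln A \<le> - ln (1 - q) / ln B" "- ln p / ln A \<le> - ln q / ln B"
    using dim by linarith+
  have "\<forall>\<^sub>F n in sequentially. (\<Sum>k=1..n. if typeA N k then - ln (1 - p) else - ln (1 - q)) - e * real n \<le> info x n"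
    if "0 < e" for e :: real
  proof (intro always_eventually allI)
    fix n
    have "0 \<le> e * real n" using that by simp
    then show "(\<Sum>k=1..n. if typeA N k then - ln (1 - p) else - ln (1 - q)) - e * real n \<le> info x n"
      using info_ge_sum[OF assms(1), of n] by linarith
  qed
  from local_dim_ge[OF assms(1) ln_bounds(1,2) ab(1) this]
  show "ereal (- ln (1 - p) / ln A) \<le> lower_local_dim \<mu> x"
    "ereal (- ln (1 - q) / ln B) \<le> upper_local_dim \<mu> x" by auto
  have "\<forall>\<^sub>F n in sequentially. info x n \<le> (\<Sum>k=1..n. if typeA N k then - ln p else - ln q) + e * real n"
    if "0 < e" for e :: real
  proof (intro always_eventually allI)
    fix n
    have "0 \<le> e * real n" using that by simp
    then show "info x n \<le> (\<Sum>k=1..n. if typeA N k then - ln p else - ln q) + e * real n"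
      using info_le_sum[OF assms(1), of n] by linarith
  qed
  from local_dim_le[OF assms(1) ln_bounds(5,6) ab(2) this]
  show "lower_local_dim \<mu> x \<le> ereal (- ln p / ln A)"
    "upper_local_dim \<mu> x \<le> ereal (- ln q / ln B)" by auto
qed

end

subsection \<open>The law of large numbers for the information content\<close>

context cantor_measure
begin

definition letter_dev :: "nat \<Rightarrow> bool \<Rightarrow> real" where
  "letter_dev k b = - ln (letter_prob k b) - Defs.entropy (rho p q N k)"

text \<open>A sum of independent centred letters: deviation of the information content from its mean.\<close>
definition dev :: "bool list \<Rightarrow> real" where
  "dev w = - ln (wt w) - (\<Sum>k=1..length w. Defs.entropy (rho p q N k))"

lemma dev_Nil [simp]: "dev [] = 0"
  by (simp add: dev_def)

lemma dev_snoc: "dev (w @ [b]) = dev w + letter_dev (Suc (length w)) b"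
  using wt_pos[of w] letter_prob_pos[of "Suc (length w)" b]
  by (simp add: dev_def letter_dev_def wt_snoc ln_mult)

lemma letter_dev_mean:
  "letter_prob k False * letter_dev k False + letter_prob k True * letter_dev k True = 0"
  by (simp add: letter_dev_def letter_prob_def Defs.entropy_def algebra_simps)

lemma entropy_eq_mean:
  "Defs.entropy (rho p q N k) = letter_prob k False * (- ln (letter_prob k False)) + letter_prob k True * (- ln (letter_prob k True))"
  by (simp add: letter_prob_def Defs.entropy_def)

text \<open>The information of a letter lies between 0 and \<open>max_info\<close>, and so does the
  entropy, being its mean; hence their difference is at most \<open>max_info\<close> in absolute
  value.\<close>

lemma letter_dev_bound: "\<bar>letter_dev k b\<bar> \<le> max_info"
proof -
  have *: "0 \<le> - ln (letter_prob k c)" "- ln (letter_prob k c) \<le> max_info" for c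
  proof -
    show "0 \<le> - ln (letter_prob k c)" using letter_prob_pos[of k c] letter_prob_bounds(2)[of k c] by simp
    have "ln (min p q) \<le> ln (letter_prob k c)"
      using letter_prob_bounds(1)[of k c] p_pos q_pos
      by (subst ln_le_cancel_iff) (auto simp: letter_prob_pos)
    then show "- ln (letter_prob k c) \<le> max_info" by (simp add: max_info_def)
  qed
  have "0 \<le> Defs.entropy (rho p q N k)"
    unfolding entropy_eq_mean using * letter_prob_pos by (intro add_nonneg_nonneg mult_nonneg_nonneg) (auto simp: less_imp_le)
  moreover have "Defs.entropy (rho p q N k) \<le> letter_prob k False * max_info + letter_prob k True * max_info"
    unfolding entropy_eq_mean using * letter_prob_pos
    by (intro add_mono mult_left_mono) (auto simp: less_imp_le)
  moreover have "\<dots> = max_info"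
    using letter_prob_sum[of k] by (simp flip: distrib_right)
  ultimately show ?thesis using *[of b] by (simp add: letter_dev_def abs_le_iff)
qed

section \<open>Moments of the centred information\<close>

lemma letter_mean_power_le:
  assumes "even m"
  shows "letter_prob k False * letter_dev k False ^ m + letter_prob k True * letter_dev k True ^ m \<le> max_info ^ m"
proof -
  have *: "letter_dev k b ^ m \<le> max_info ^ m" for b
    using power_mono[OF letter_dev_bound[of k b], of m] assms by (simp add: power_even_abs)
  have "letter_prob k False * letter_dev k False ^ m + letter_prob k True * letter_dev k True ^ m
      \<le> letter_prob k False * max_info ^ m + letter_prob k True * max_info ^ m"
    using * letter_prob_pos by (intro add_mono mult_left_mono) (auto simp: less_imp_le)
  also have "\<dots> = max_info ^ m"
    using letter_prob_sum[of k] by (simp flip: distrib_right)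
  finally show ?thesis .
qed

text \<open>The last letter has mean deviation 0 whatever the prefix.\<close>

lemma mean_dev: "(\<Sum>w | length w = n. wt w * dev w) = 0"
proof (induction n)
  case (Suc n)
  have "(\<Sum>w | length w = Suc n. wt w * dev w) = (\<Sum>w | length w = n. wt w * dev w)"
    unfolding sum_wt_Suc
  proof (intro sum.cong refl)
    fix w :: "bool list" assume "w \<in> {w. length w = n}"
    let ?P = "letter_prob (Suc n)" and ?D = "letter_dev (Suc n)"
    have "?P False * dev (w @ [False]) + ?P True * dev (w @ [True])
       = (?P False + ?P True) * dev w + (?P False * ?D False + ?P True * ?D True)"
      using \<open>w \<in> _\<close> by (simp add: dev_snoc algebra_simps)
    then show "wt w * (?P False * dev (w @ [False]) + ?P True * dev (w @ [True])) = wt w * dev w"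
      by (simp add: letter_prob_sum letter_dev_mean)
  qed
  then show ?case using Suc by simp
qed simp

text \<open>The cross term vanishes by \<open>letter_dev_mean\<close>, so each level adds at most
  \<open>max_info ^ 2\<close>.\<close>

lemma mean_dev_square: "(\<Sum>w | length w = n. wt w * dev w ^ 2) \<le> real n * max_info ^ 2"
proof (induction n)
  case (Suc n)
  have "(\<Sum>w | length w = Suc n. wt w * dev w ^ 2) \<le> (\<Sum>w | length w = n. wt w * dev w ^ 2 + wt w * max_info ^ 2)"
    unfolding sum_wt_Suc
  proof (intro sum_mono)
    fix w :: "bool list" assume "w \<in> {w. length w = n}"
    let ?P = "letter_prob (Suc n)" and ?D = "letter_dev (Suc n)"
    have "?P False * dev (w @ [False]) ^ 2 + ?P True * dev (w @ [True]) ^ 2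
       = (?P False + ?P True) * dev w ^ 2 + 2 * dev w * (?P False * ?D False + ?P True * ?D True)
         + (?P False * ?D False ^ 2 + ?P True * ?D True ^ 2)"
      using \<open>w \<in> _\<close> by (simp add: dev_snoc power2_eq_square algebra_simps)
    also have "\<dots> \<le> dev w ^ 2 + max_info ^ 2"
      using letter_mean_power_le[of 2 "Suc n"] by (simp add: letter_prob_sum letter_dev_mean)
    finally show "wt w * (?P False * dev (w @ [False]) ^ 2 + ?P True * dev (w @ [True]) ^ 2)
       \<le> wt w * dev w ^ 2 + wt w * max_info ^ 2"
      using wt_pos[of w] by (simp flip: distrib_left)
  qed
  also have "\<dots> = (\<Sum>w | length w = n. wt w * dev w ^ 2) + max_info ^ 2"
    by (simp add: sum.distrib sum_wt flip: sum_distrib_right)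
  finally show ?case using Suc by (simp add: algebra_simps)
qed simp

lemma mean_dev_fourth: "(\<Sum>w | length w = n. wt w * dev w ^ 4) \<le> 3 * real n ^ 2 * max_info ^ 4"
proof (induction n)
  case (Suc n)
  let ?P = "letter_prob (Suc n)" and ?D = "letter_dev (Suc n)"
  \<comment> \<open>The third moment of the new letter need not vanish, but it is the same for all
    words and multiplies the first moment of \<open>dev\<close>, which is 0.\<close>
  let ?c = "?P False * ?D False ^ 3 + ?P True * ?D True ^ 3"
  have "(\<Sum>w | length w = Suc n. wt w * dev w ^ 4) \<le> (\<Sum>w | length w = n.
     wt w * dev w ^ 4 + 6 * max_info ^ 2 * (wt w * dev w ^ 2) + 4 * ?c * (wt w * dev w) + wt w * max_info ^ 4)"
    unfolding sum_wt_Suc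
  proof (intro sum_mono)
    fix w :: "bool list" assume "w \<in> {w. length w = n}"
    have four: "(a + d) ^ 4 = a ^ 4 + 4 * a ^ 3 * d + 6 * a ^ 2 * d ^ 2 + 4 * a * d ^ 3 + d ^ 4" for a d :: real
      by (simp add: power4_eq_xxxx power3_eq_cube power2_eq_square algebra_simps)
    have "?P False * dev (w @ [False]) ^ 4 + ?P True * dev (w @ [True]) ^ 4
       = (?P False + ?P True) * dev w ^ 4 + 4 * dev w ^ 3 * (?P False * ?D False + ?P True * ?D True)
         + 6 * dev w ^ 2 * (?P False * ?D False ^ 2 + ?P True * ?D True ^ 2) + 4 * dev w * ?c
         + (?P False * ?D False ^ 4 + ?P True * ?D True ^ 4)"
      using \<open>w \<in> _\<close> by (simp add: dev_snoc four algebra_simps)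
    also have "\<dots> \<le> dev w ^ 4 + 6 * dev w ^ 2 * max_info ^ 2 + 4 * dev w * ?c + max_info ^ 4"
      using letter_mean_power_le[of 4 "Suc n"]
        mult_left_mono[OF letter_mean_power_le[of 2 "Suc n"], of "6 * dev w ^ 2"]
      by (simp add: letter_prob_sum letter_dev_mean)
    finally have "wt w * (?P False * dev (w @ [False]) ^ 4 + ?P True * dev (w @ [True]) ^ 4)
       \<le> wt w * (dev w ^ 4 + 6 * dev w ^ 2 * max_info ^ 2 + 4 * dev w * ?c + max_info ^ 4)"
      using wt_pos[of w] by (intro mult_left_mono) auto
    also have "\<dots> = wt w * dev w ^ 4 + 6 * max_info ^ 2 * (wt w * dev w ^ 2) + 4 * ?c * (wt w * dev w) + wt w * max_info ^ 4"
      by (simp add: algebra_simps)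
    finally show "wt w * (?P False * dev (w @ [False]) ^ 4 + ?P True * dev (w @ [True]) ^ 4)
       \<le> wt w * dev w ^ 4 + 6 * max_info ^ 2 * (wt w * dev w ^ 2) + 4 * ?c * (wt w * dev w) + wt w * max_info ^ 4" .
  qed
  also have "\<dots> = (\<Sum>w | length w = n. wt w * dev w ^ 4) + 6 * max_info ^ 2 * (\<Sum>w | length w = n. wt w * dev w ^ 2) + max_info ^ 4"
    by (simp add: sum.distrib mean_dev sum_wt flip: sum_distrib_right sum_distrib_left)
  also have "\<dots> \<le> 3 * real n ^ 2 * max_info ^ 4 + 6 * max_info ^ 2 * (real n * max_info ^ 2) + max_info ^ 4"
    using Suc mean_dev_square[of n] max_info_pos by (intro add_mono mult_left_mono) auto
  \<comment> \<open>The moment has grown by at most \<open>6 * n + 1\<close> times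
    \<open>max_info ^ 4\<close>, the bound by \<open>6 * n + 3\<close> times.\<close>
  also have "\<dots> \<le> 3 * real (Suc n) ^ 2 * max_info ^ 4"
    using max_info_pos by (simp add: power2_eq_square power4_eq_xxxx algebra_simps)
  finally show ?case .
qed simp

text \<open>Markov's inequality for the fourth moment bounds the mass of the bad words of length
  \<open>n\<close> by a constant over the square of \<open>n\<close>, which is summable, so
  Borel-Cantelli applies. The second moment would only give order \<open>1 / n\<close>.\<close>

lemma AE_dev_small:
  assumes "0 < e"
  shows "AE x in \<mu>. \<forall>\<^sub>F n in sequentially. x \<in> X \<longrightarrow> \<bar>dev (code x n)\<bar> \<le> e * real n"
proof -
  define V where "V n = {w. length w = n \<and> e * real n < \<bar>dev w\<bar>}" for n
  define bad where "bad n = (\<Union>w\<in>V n. I w)" for n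
  have V: "V n \<subseteq> {w. length w = n}" for n by (auto simp: V_def)
  have finV: "finite (V n)" for n using V finite_words finite_subset by blast
  have bad_sets: "bad n \<in> sets \<mu>" for n
    unfolding bad_def using finV by (intro sets.finite_UN) auto
  have bound: "measure \<mu> (bad n) \<le> 3 * max_info ^ 4 / e ^ 4 * (1 / real n ^ 2)" if n: "0 < n" for n
  proof -
    have en: "0 < e * real n" using assms n by simp
    have "measure \<mu> (bad n) * (e * real n) ^ 4 = (\<Sum>w\<in>V n. wt w * (e * real n) ^ 4)"
      unfolding bad_def measure_words[OF V] by (simp add: sum_distrib_right)
    also have "\<dots> \<le> (\<Sum>w\<in>V n. wt w * dev w ^ 4)"
    proof (intro sum_mono mult_left_mono)
      fix w assume "w \<in> V n"
      then have "e * real n \<le> \<bar>dev w\<bar>" by (simp add: V_def)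
      then have "(e * real n) ^ 4 \<le> \<bar>dev w\<bar> ^ 4" using en by (intro power_mono) auto
      then show "(e * real n) ^ 4 \<le> dev w ^ 4" by (simp add: power_even_abs)
    qed (use wt_pos in \<open>auto simp: less_imp_le\<close>)
    also have "\<dots> \<le> (\<Sum>w | length w = n. wt w * dev w ^ 4)"
      using V finite_words wt_pos by (intro sum_mono2) (auto simp: less_imp_le)
    also have "\<dots> \<le> 3 * real n ^ 2 * max_info ^ 4" by (rule mean_dev_fourth)
    finally have "measure \<mu> (bad n) \<le> 3 * real n ^ 2 * max_info ^ 4 / (e * real n) ^ 4"
      using zero_less_power[OF en, of 4] by (subst pos_le_divide_eq) auto
    also have "\<dots> = 3 * max_info ^ 4 / e ^ 4 * (1 / real n ^ 2)"
      using assms n by (simp add: field_simps power4_eq_xxxx power2_eq_square)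
    finally show ?thesis .
  qed
  have "summable (\<lambda>n. 3 * max_info ^ 4 / e ^ 4 * (1 / real n ^ 2))"
    using inverse_power_summable[of 2, where ?'a = real] by (intro summable_mult) (simp add: inverse_eq_divide)
  then have "summable (\<lambda>n. measure \<mu> (bad n))"
    by (rule summable_comparison_test'[where N = 1]) (use bound in auto)
  then have "AE x in \<mu>. \<forall>\<^sub>F n in sequentially. x \<in> space \<mu> - bad n"
    using bad_sets by (intro borel_cantelli_AE1) (auto simp: emeasure_eq_measure)
  then show ?thesis
  proof eventually_elim
    case (elim x)
    then show ?case
    proof eventually_elim
      case (elim n)
      show ?case
      proof
        assume "x \<in> X"
        with elim have "code x n \<notin> V n" by (auto simp: bad_def code)
        then show "\<bar>dev (code x n)\<bar> \<le> e * real n" using \<open>x \<in> X\<close> by (simp add: V_def code)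
      qed
    qed
  qed
qed

lemma AE_local_dim:
  assumes dim: "- ln p / ln A < - ln (1 - q) / ln B"
  shows "AE x in \<mu>. lower_local_dim \<mu> x = ereal (Defs.entropy p / ln A) \<and>
                     upper_local_dim \<mu> x = ereal (Defs.entropy q / ln B)"
proof -
  \<comment> \<open>The exceptional null set depends on the tolerance; countably many tolerances
    serve for all.\<close>
  have "AE x in \<mu>. \<forall>m. \<forall>\<^sub>F n in sequentially. x \<in> X \<longrightarrow> \<bar>dev (code x n)\<bar> \<le> 1 / real (Suc m) * real n"
    unfolding AE_all_countable by (intro allI AE_dev_small) simp
  then show ?thesis using AE_X
  proof eventually_elim
    case (elim x)
    have sums: "(\<Sum>k=1..n. Defs.entropy (rho p q N k)) = (\<Sum>k=1..n. if typeA N k then Defs.entropy p else Defs.entropy q)" for n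
      by (intro sum.cong) (auto simp: rho_def)
    have dev: "dev (code x n) = info x n - (\<Sum>k=1..n. if typeA N k then Defs.entropy p else Defs.entropy q)" for n
      unfolding dev_def info_def length_code[OF elim(2)] sums ..
    have small: "\<forall>\<^sub>F n in sequentially. \<bar>dev (code x n)\<bar> \<le> e * real n" if "0 < e" for e :: real
    proof -
      obtain m where m: "1 / real (Suc m) < e" using nat_approx_posE \<open>0 < e\<close> by blast
      have "\<forall>\<^sub>F n in sequentially. x \<in> X \<longrightarrow> \<bar>dev (code x n)\<bar> \<le> 1 / real (Suc m) * real n"
        using elim(1) by blast
      then show ?thesis
      proof eventually_elim
        case (elim n)
        have "1 / real (Suc m) * real n \<le> e * real n" using m by (intro mult_right_mono) auto
        then show ?case using elim \<open>x \<in> X\<close> by linarith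
      qed
    qed
    \<comment> \<open>The assumed inequality is squeezed between the two entropy quotients, which
      orders them.\<close>
    have "Defs.entropy p / ln A \<le> - ln p / ln A"
      by (rule divide_right_mono[OF entropy_pos_bounds(2)[OF p_pos p_le]]) (use ln_ratio_pos in simp)
    moreover have "- ln (1 - q) / ln B \<le> Defs.entropy q / ln B"
      by (rule divide_right_mono[OF entropy_pos_bounds(3)[OF q_pos q_le]]) (use ln_ratio_pos in simp)
    ultimately have ab: "Defs.entropy p / ln A \<le> Defs.entropy q / ln B" using dim by linarith
    note pos = entropy_pos_bounds(1)[OF p_pos p_le] entropy_pos_bounds(1)[OF q_pos q_le]
    have "\<forall>\<^sub>F n in sequentially. (\<Sum>k=1..n. if typeA N k then Defs.entropy p else Defs.entropy q) - e * real n \<le> info x n"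
      if "0 < e" for e :: real
      using small[OF that] by eventually_elim (simp add: dev abs_le_iff)
    note ge = local_dim_ge[OF elim(2) pos ab this]
    have "\<forall>\<^sub>F n in sequentially. info x n \<le> (\<Sum>k=1..n. if typeA N k then Defs.entropy p else Defs.entropy q) + e * real n"
      if "0 < e" for e :: real
      using small[OF that] by eventually_elim (simp add: dev abs_le_iff)
    note le = local_dim_le[OF elim(2) pos ab this]
    show ?case using ge le by (simp add: antisym)
  qed
qed

end

subsection \<open>Hausdorff and packing dimension\<close>

context cantor_scheme
begin

text \<open>The point whose cylinders are the prefixes of \<omega>; its law under fair coin tosses is the
  measure for p = q = 1/2.\<close>
definition coding :: "(nat \<Rightarrow> bool) \<Rightarrow> real" where
  "coding \<omega> = (\<Sum>k. of_bool (\<omega> k) * (len k - len (Suc k)))"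

lemma left_end_map: "left_end (map \<omega> [0..<n]) = (\<Sum>k<n. of_bool (\<omega> k) * (len k - len (Suc k)))"
  by (induction n) (auto simp: left_end_snoc)

text \<open>The first \<open>n\<close> terms sum to the left end of the prefix cylinder; the tail is
  nonnegative and bounded by a telescoping series with sum \<open>len n\<close>.\<close>

lemma coding_in_I: "coding \<omega> \<in> I (map \<omega> [0..<n])"
proof -
  let ?f = "\<lambda>k. of_bool (\<omega> k) * (len k - len (Suc k)) :: real"
  have "(\<lambda>k. len (k + n)) \<longlonglongrightarrow> 0" using len_tendsto_0 by (rule LIMSEQ_ignore_initial_segment)
  then have tele: "(\<lambda>k. len (k + n) - len (Suc k + n)) sums (len (0 + n) - 0)"
    by (rule telescope_sums')
  have f: "0 \<le> ?f k" "?f k \<le> len k - len (Suc k)" for k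
    using len_Suc_less[of k] by (auto simp: of_bool_def)
  have sum_tail: "summable (\<lambda>k. ?f (k + n))"
    using sums_summable[OF tele] by (rule summable_comparison_test'[where N = 0]) (use f in \<open>auto simp: abs_of_nonneg\<close>)
  then have "coding \<omega> = (\<Sum>k. ?f (k + n)) + left_end (map \<omega> [0..<n])"
    unfolding coding_def left_end_map using summable_iff_shift[of ?f n] by (intro suminf_split_initial_segment) auto
  moreover have "0 \<le> (\<Sum>k. ?f (k + n))" using sum_tail f by (intro suminf_nonneg) auto
  moreover have "(\<Sum>k. ?f (k + n)) \<le> len n"
    using suminf_le[OF _ sum_tail sums_summable[OF tele]] f(2)[of "_ + n"] sums_unique[OF tele] by simp
  ultimately show ?thesis by (simp add: I_eq)
qed

lemma coding_in_I_iff: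
  assumes "length w = n"
  shows "coding \<omega> \<in> I w \<longleftrightarrow> (\<forall>i<n. \<omega> i = w ! i)"
proof -
  have "coding \<omega> \<in> I w \<longleftrightarrow> map \<omega> [0..<n] = w"
    using coding_in_I[of \<omega> n] I_unique[of "map \<omega> [0..<n]" w] assms by auto
  also have "\<dots> \<longleftrightarrow> (\<forall>i<n. \<omega> i = w ! i)" using assms by (auto simp: list_eq_iff_nth_eq)
  finally show ?thesis .
qed

text \<open>The law of \<open>coding\<close> under independent fair coins: the preimage of
  \<open>I w\<close> prescribes exactly the first \<open>length w\<close> tosses.\<close>

lemma uniform_measure_exists: "\<exists>\<nu>. cantor_measure A B N (1/2) (1/2) \<nu>"
proof -
  let ?M = "\<lambda>_::nat. measure_pmf (bernoulli_pmf (1/2))"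
  let ?P = "Pi\<^sub>M UNIV ?M"
  interpret product_prob_space ?M UNIV ..
  have meas [measurable]: "coding \<in> borel_measurable ?P"
    unfolding coding_def by measurable
  have "cantor_measure A B N (1/2) (1/2) (distr ?P borel coding)"
  proof (intro cantor_measure.intro cantor_measure_axioms.intro)
    show "cantor_scheme A B N" by (rule cantor_scheme_axioms)
    show "prob_space (distr ?P borel coding)" using meas by (rule P.prob_space_distr)
    fix w
    have "measure (distr ?P borel coding) (I w) = measure ?P (coding -` I w \<inter> space ?P)"
      using closed_I meas by (intro measure_distr) auto
    also have "coding -` I w \<inter> space ?P = prod_emb UNIV ?M {..<length w} (Pi\<^sub>E {..<length w} (\<lambda>i. {w ! i}))"
      using coding_in_I_iff[OF refl, of _ w] by (auto simp: prod_emb_def space_PiM PiE_iff)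
    also have "measure ?P \<dots> = (\<Prod>i<length w. measure (?M i) {w ! i})"
      by (rule measure_PiM_emb) auto
    also have "\<dots> = (\<Prod>i<length w. 1/2)"
      by (intro prod.cong refl) (simp add: measure_pmf_single pmf_bernoulli_half)
    finally show "measure (distr ?P borel coding) (I w) = weight (1/2) (1/2) N w"
      by (simp add: weight_half)
  qed auto
  then show ?thesis by blast
qed

section \<open>Growth of the sum of s-th powers of the lengths of one level\<close>

lemma two_power_len_powr: "2 ^ n * len n powr s = exp (real n * ln 2 - s * log_len n)"
proof -
  have "(2::real) ^ n = exp (real n * ln 2)" by (simp add: exp_of_nat_mult)
  moreover have "len n powr s = exp (- s * log_len n)"
    by (simp add: len_eq_exp powr_def)
  ultimately show ?thesis by (simp flip: exp_add)
qed

text \<open>At the ends of type A blocks \<open>log_len n / n\<close> tends to \<open>ln A\<close>,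
  so the exponent in \<open>two_power_len_powr\<close> eventually drops below
  \<open>- c * n\<close>.\<close>

lemma two_power_len_small:
  assumes "ln 2 / ln A < s" "0 < e"
  shows "\<exists>\<^sub>F n in sequentially. 2 ^ n * len n powr s \<le> e"
proof (rule frequently_subseq[OF filterlim_N_odd])
  let ?g = "\<lambda>i. N (Suc (2*i))"
  define c where "c = (s * ln A - ln 2) / 2"
  have c: "0 < c" using assms ln_ratio_pos by (simp add: c_def field_simps)
  have "(\<lambda>i. s * (log_len (?g i) / real (?g i))) \<longlonglongrightarrow> s * ln A"
    unfolding log_len_eq_sum by (intro tendsto_intros average_tendsto_typeA)
  moreover have "ln 2 + c < s * ln A" using c unfolding c_def by argo
  ultimately have 1: "\<forall>\<^sub>F i in sequentially. ln 2 + c < s * (log_len (?g i) / real (?g i))"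
    by (rule order_tendstoD)
  have 2: "\<forall>\<^sub>F i in sequentially. - ln e \<le> c * real (?g i)"
    using eventually_const_le[OF c] filterlim_N_odd by (rule eventually_compose_filterlim)
  show "\<forall>\<^sub>F i in sequentially. 2 ^ ?g i * len (?g i) powr s \<le> e"
    using 1 2
  proof eventually_elim
    case (elim i)
    have "0 < real (?g i)" using N_ge[of "Suc (2*i)"] by simp
    then have "real (?g i) * ln 2 - s * log_len (?g i) \<le> - (c * real (?g i))"
      using elim(1) by (simp add: field_simps)
    then have "real (?g i) * ln 2 - s * log_len (?g i) \<le> ln e" using elim(2) by linarith
    then show ?case using assms(2) unfolding two_power_len_powr by (metis exp_le_cancel_iff exp_ln)
  qed
qed

text \<open>At the ends of type B blocks \<open>log_len n / n\<close> tends to \<open>ln B\<close>,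
  so the exponent eventually exceeds \<open>c * n\<close>.\<close>

lemma two_power_len_large:
  assumes "s < ln 2 / ln B"
  shows "\<exists>\<^sub>F n in sequentially. K \<le> 2 ^ n * len n powr s"
proof (rule frequently_subseq[OF filterlim_N_even])
  let ?g = "\<lambda>i. N (Suc (Suc (2*i)))"
  define c where "c = (ln 2 - s * ln B) / 2"
  have c: "0 < c" using assms ln_ratio_pos by (simp add: c_def field_simps)
  have "(\<lambda>i. s * (log_len (?g i) / real (?g i))) \<longlonglongrightarrow> s * ln B"
    unfolding log_len_eq_sum by (intro tendsto_intros average_tendsto_typeB)
  moreover have "s * ln B < ln 2 - c" using c unfolding c_def by argo
  ultimately have 1: "\<forall>\<^sub>F i in sequentially. s * (log_len (?g i) / real (?g i)) < ln 2 - c"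
    by (rule order_tendstoD)
  have 2: "\<forall>\<^sub>F i in sequentially. K \<le> c * real (?g i)"
    using eventually_const_le[OF c] filterlim_N_even by (rule eventually_compose_filterlim)
  show "\<forall>\<^sub>F i in sequentially. K \<le> 2 ^ ?g i * len (?g i) powr s"
    using 1 2
  proof eventually_elim
    case (elim i)
    have "0 < real (?g i)" using N_ge[of "Suc (Suc (2*i))"] by simp
    then have "c * real (?g i) \<le> real (?g i) * ln 2 - s * log_len (?g i)"
      using elim(1) by (simp add: field_simps)
    then have "K \<le> real (?g i) * ln 2 - s * log_len (?g i)" using elim(2) by linarith
    then show ?case unfolding two_power_len_powr
      using exp_ge_add_one_self[of "real (?g i) * ln 2 - s * log_len (?g i)"] by linarith
  qed
qed

section \<open>Hausdorff dimension\<close>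

lemma hausdorff_measure_eq_0:
  assumes s: "ln 2 / ln A < s"
  shows "hausdorff_measure s X = 0"
proof -
  \<comment> \<open>The cover consists of all cylinders of one level, deep enough for their length
    to be below \<open>\<delta>\<close> and for the sum of powers to be at most
    \<open>e\<close>.\<close>
  have pre: "hausdorff_pre s \<delta> X \<le> 0 + ennreal e" if "0 < \<delta>" "0 < e" for \<delta> e
  proof -
    have "\<forall>\<^sub>F n in sequentially. len n < \<delta>"
      using len_tendsto_0 \<open>0 < \<delta>\<close> by (rule order_tendstoD)
    with two_power_len_small[OF s \<open>0 < e\<close>]
    have "\<exists>\<^sub>F n in sequentially. len n < \<delta> \<and> 2 ^ n * len n powr s \<le> e"
      by (rule frequently_eventually_conj)
    then obtain n where n: "2 ^ n * len n powr s \<le> e" "len n < \<delta>"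
      using frequently_ex by blast
    obtain f :: "nat \<Rightarrow> bool list" where f: "bij_betw f {..<2 ^ n} {w. length w = n}" by (rule enumerate_words)
    \<comment> \<open>Covers are sequences, so the cylinders are padded with empty sets, whose
      diameter 0 contributes \<open>0 powr s = 0\<close>.\<close>
    define U where "U i = (if i < 2 ^ n then I (f i) else {})" for i :: nat
    have lenf: "length (f i) = n" if "i < 2 ^ n" for i
      using bij_betwE[OF f] that by auto
    have diam: "diameter (U i) = (if i < 2 ^ n then len n else 0)" for i
      using len_pos[of n] lenf by (auto simp: U_def I_eq not_less)
    have cover: "X \<subseteq> (\<Union>i. U i)"
    proof
      fix x assume "x \<in> X"
      then obtain w where w: "length w = n" "x \<in> I w" by (auto simp: X_iff)
      then have "w \<in> f ` {..<2 ^ n}" using bij_betw_imp_surj_on[OF f] by simp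
      then obtain i where "i < 2 ^ n" "f i = w" by auto
      then show "x \<in> (\<Union>i. U i)" using w by (auto simp: U_def intro!: exI[of _ i])
    qed
    have "(\<Sum>i. ennreal (diameter (U i) powr s)) = (\<Sum>i<2 ^ n. ennreal (diameter (U i) powr s))"
      by (rule suminf_finite) (auto simp: diam)
    also have "\<dots> = (\<Sum>i<(2::nat) ^ n. ennreal (len n powr s))"
      by (intro sum.cong) (auto simp: diam)
    also have "\<dots> = ennreal (\<Sum>i<(2::nat) ^ n. len n powr s)"
      by (rule sum_ennreal) auto
    also have "\<dots> = ennreal (2 ^ n * len n powr s)"
      by simp
    also have "\<dots> \<le> ennreal e" using n by (intro ennreal_leI)
    finally have "(\<Sum>i. ennreal (diameter (U i) powr s)) \<le> ennreal e" .
    moreover have "hausdorff_pre s \<delta> X \<le> (\<Sum>i. ennreal (diameter (U i) powr s))"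
      unfolding hausdorff_pre_def
    proof (intro Inf_lower CollectI exI[of _ U] conjI refl cover allI)
      fix i
      show "bounded (U i)" by (auto simp: U_def I_eq)
      show "diameter (U i) \<le> \<delta>" using n \<open>0 < \<delta>\<close> by (auto simp: diam)
    qed
    ultimately show ?thesis by (simp add: order_trans)
  qed
  have "hausdorff_pre s \<delta> X \<le> 0" if "0 < \<delta>" for \<delta>
    by (rule ennreal_le_epsilon) (rule pre[OF that])
  then show ?thesis unfolding hausdorff_measure_def
    by (intro antisym SUP_least) simp_all
qed

text \<open>Since \<open>log_len n\<close> is at most \<open>real n * ln A\<close>. The left side is
  the fair coin mass of a cylinder.\<close>

lemma half_power_le_len_powr:
  assumes "0 \<le> s" "s \<le> ln 2 / ln A"
  shows "(1/2) ^ n \<le> len n powr s"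
proof -
  have "s * log_len n \<le> s * (real n * ln A)" using log_len_le assms by (intro mult_left_mono) auto
  also have "\<dots> = real n * (s * ln A)" by simp
  also have "\<dots> \<le> real n * ln 2" using assms ln_ratio_pos by (intro mult_left_mono) (auto simp: field_simps)
  finally have "1 \<le> 2 ^ n * len n powr s" unfolding two_power_len_powr by simp
  then show ?thesis by (simp add: field_simps)
qed

lemma len_powr_le_half_power:
  assumes "s = ln 2 / ln B"
  shows "len n powr s \<le> (1/2) ^ n"
proof -
  have "s * (real n * ln B) \<le> s * log_len n" using log_len_ge assms ln_ratio_pos by (intro mult_left_mono) auto
  moreover have "s * (real n * ln B) = real n * ln 2" using assms ln_ratio_pos by simp
  ultimately have "2 ^ n * len n powr s \<le> 1" unfolding two_power_len_powr by simp
  then show ?thesis by (simp add: field_simps)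
qed

text \<open>Mass distribution principle: the fair coin mass of a ball of radius \<open>d\<close> is
  at most \<open>C * d powr s\<close>, while the sets of a cover must account for total mass
  1.\<close>

lemma hausdorff_measure_pos:
  assumes s: "0 \<le> s" "s \<le> ln 2 / ln A"
  shows "hausdorff_measure s X \<noteq> 0"
proof -
  obtain \<nu> where "cantor_measure A B N (1/2) (1/2) \<nu>" using uniform_measure_exists by blast
  then interpret \<nu>: cantor_measure A B N "1/2" "1/2" \<nu> .
  \<comment> \<open>Passing up \<open>shift\<close> levels multiplies the mass by this factor; on
    the first levels it makes the bound exceed 1, so that it is trivial.\<close>
  define C where "C = (2::real) ^ \<nu>.shift"
  have C: "0 < C" by (simp add: C_def)
  have ball: "measure \<nu> (cball x d) \<le> C * d powr s" if x: "x \<in> X" and d: "0 \<le> d" "d < 1" for x d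
  proof (cases "d = 0")
    \<comment> \<open>A set of the cover may be a single point, and \<open>0 powr s\<close> is 0
      even for \<open>s = 0\<close>; so points must be shown to be null.\<close>
    case True
    have "measure \<nu> (cball x d) \<le> (1/2) ^ n" for n
    proof -
      have "measure \<nu> (cball x d) \<le> (1/2) ^ Suc n"
        using \<nu>.measure_cball_le[OF x, of d n] gap_pos len_pos[of n] True
        by (simp add: weight_half length_code x)
      also have "\<dots> \<le> (1/2) ^ n" by simp
      finally show ?thesis .
    qed
    then have "measure \<nu> (cball x d) \<le> 0"
      using LIMSEQ_le_const[OF LIMSEQ_realpow_zero[of "1/2::real"]] by simp
    then show ?thesis using True by simp
  next
    case False
    then have "0 < d" using d by simp
    then obtain n where n: "len (Suc n) \<le> d" "d < len n" using len_bracket d by blast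
    have "measure \<nu> (cball x d) \<le> C * (1/2) ^ Suc n"
    proof (cases "\<nu>.shift \<le> n")
      case True
      have "measure \<nu> (cball x d) \<le> (1/2) ^ Suc (n - \<nu>.shift)"
        using \<nu>.measure_cball_le_shift[OF x, of d "n - \<nu>.shift"] n True
        by (simp add: weight_half length_code x)
      also have "\<dots> = C * (1/2) ^ Suc n"
        using True by (simp add: C_def power_one_over power_diff field_simps)
      finally show ?thesis .
    next
      case False
      have "(2::real) ^ Suc n \<le> 2 ^ \<nu>.shift" using False by (intro power_increasing) auto
      then have "1 \<le> C * (1/2) ^ Suc n" by (simp add: C_def power_one_over field_simps)
      then show ?thesis using \<nu>.prob_le_1[of "cball x d"] by linarith
    qed
    also have "\<dots> \<le> C * len (Suc n) powr s"
      using C half_power_le_len_powr[OF s, of "Suc n"] by (intro mult_left_mono) auto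
    also have "\<dots> \<le> C * d powr s"
      using C n len_pos[of "Suc n"] s by (intro mult_left_mono powr_mono2) auto
    finally show ?thesis .
  qed
  have "ennreal (1 / C) \<le> hausdorff_pre s (1/2) X"
    unfolding hausdorff_pre_def
  proof (intro Inf_greatest)
    fix S assume "S \<in> {(\<Sum>i. ennreal (diameter (U i) powr s)) | U :: nat \<Rightarrow> real set.
      X \<subseteq> (\<Union>i. U i) \<and> (\<forall>i. bounded (U i) \<and> diameter (U i) \<le> 1/2)}"
    then obtain U :: "nat \<Rightarrow> real set" where S: "S = (\<Sum>i. ennreal (diameter (U i) powr s))"
      and cover: "X \<subseteq> (\<Union>i. U i)" and U: "\<And>i. bounded (U i)" "\<And>i. diameter (U i) \<le> 1/2"
      by blast
    \<comment> \<open>Sets of a cover need not be measurable: each is replaced by the ball around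
      one of its points in \<open>X\<close> with its diameter as radius, or by the empty set if it
      misses \<open>X\<close>.\<close>
    have "\<exists>T. T \<in> sets \<nu> \<and> U i \<inter> X \<subseteq> T \<and> measure \<nu> T \<le> C * diameter (U i) powr s" for i
    proof (cases "U i \<inter> X = {}")
      case True
      then show ?thesis using C by (intro exI[of _ "{}"]) auto
    next
      case False
      then obtain x where x: "x \<in> U i" "x \<in> X" by blast
      have "U i \<subseteq> cball x (diameter (U i))"
        using diameter_bounded_bound[OF U(1)] x by auto
      then show ?thesis
        using ball[OF x(2), of "diameter (U i)"] U(2)[of i] diameter_ge_0[OF U(1)[of i]]
        by (intro exI[of _ "cball x (diameter (U i))"]) auto
    qed
    then obtain T where T: "\<And>i. T i \<in> sets \<nu>" "\<And>i. U i \<inter> X \<subseteq> T i"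
      "\<And>i. measure \<nu> (T i) \<le> C * diameter (U i) powr s" by metis
    have "X \<in> sets \<nu>" using closed_X by (simp add: \<nu>.sets_mu borel_closed)
    then have "1 = emeasure \<nu> X" using \<nu>.AE_X \<nu>.prob_eq_1 by (simp add: \<nu>.emeasure_eq_measure)
    also have "\<dots> \<le> emeasure \<nu> (\<Union>i. T i)"
    proof (rule emeasure_mono)
      show "X \<subseteq> (\<Union>i. T i)"
      proof
        fix x assume "x \<in> X"
        then obtain i where "x \<in> U i" using cover by blast
        then show "x \<in> (\<Union>i. T i)" using T(2)[of i] \<open>x \<in> X\<close> by blast
      qed
      show "(\<Union>i. T i) \<in> sets \<nu>" using T(1) by (intro sets.countable_UN) auto
    qed
    also have "\<dots> \<le> (\<Sum>i. emeasure \<nu> (T i))"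
      using T(1) by (intro emeasure_subadditive_countably) auto
    also have "\<dots> \<le> (\<Sum>i. ennreal C * ennreal (diameter (U i) powr s))"
      using T(3) C by (intro suminf_le) (auto simp: \<nu>.emeasure_eq_measure ennreal_mult[symmetric] intro!: ennreal_leI)
    also have "\<dots> = ennreal C * S" by (simp add: S ennreal_suminf_cmult)
    finally have "ennreal (1 / C) * 1 \<le> ennreal (1 / C) * (ennreal C * S)"
      by (intro mult_left_mono) auto
    also have "\<dots> = ennreal (1 / C * C) * S" using C by (subst ennreal_mult) (auto simp: mult.assoc)
    finally show "ennreal (1 / C) \<le> S" using C by simp
  qed
  also have "\<dots> \<le> hausdorff_measure s X"
    unfolding hausdorff_measure_def by (rule SUP_upper) simp
  finally show ?thesis using C by auto
qed

lemma hausdorff_dim_X: "hausdorff_dim X = ereal (ln 2 / ln A)"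
proof (rule antisym)
  have pos: "0 < ln 2 / ln A" using ln_ratio_pos by simp
  show "hausdorff_dim X \<le> ereal (ln 2 / ln A)"
  proof (rule ereal_le_epsilon2)
    fix e :: real assume "0 < e"
    then have "hausdorff_measure (ln 2 / ln A + e) X = 0" by (intro hausdorff_measure_eq_0) simp
    then have "hausdorff_dim X \<le> ereal (ln 2 / ln A + e)"
      unfolding hausdorff_dim_def using pos \<open>0 < e\<close> by (intro Inf_lower) auto
    then show "hausdorff_dim X \<le> ereal (ln 2 / ln A) + ereal e" by simp
  qed
  show "ereal (ln 2 / ln A) \<le> hausdorff_dim X"
    unfolding hausdorff_dim_def
  proof (intro Inf_greatest)
    fix y assume "y \<in> {ereal s | s. 0 \<le> s \<and> hausdorff_measure s X = 0}"
    then obtain s where s: "y = ereal s" "0 \<le> s" "hausdorff_measure s X = 0" by blast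
    then have "\<not> s \<le> ln 2 / ln A" using hausdorff_measure_pos by blast
    then show "ereal (ln 2 / ln A) \<le> y" by (simp add: s(1))
  qed
qed

section \<open>Packing dimension\<close>

lemma packing_measure_eq_0:
  assumes s: "ln 2 / ln B < s"
  shows "packing_measure s X = 0"
proof -
  obtain \<nu> where "cantor_measure A B N (1/2) (1/2) \<nu>" using uniform_measure_exists by blast
  then interpret \<nu>: cantor_measure A B N "1/2" "1/2" \<nu> .
  define t where "t = ln 2 / ln B"
  have t: "0 < t" "t < s" using s ln_ratio_pos by (auto simp: t_def)
  \<comment> \<open>The factor \<open>2 powr s\<close> passes from diameters to radii; the factor 2
    is the ratio of the fair coin masses at levels \<open>n\<close> and
    \<open>Suc n\<close>.\<close>
  define K where "K \<delta> = 2 powr s * 2 * \<delta> powr (s - t)" for \<delta> :: real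
  \<comment> \<open>Disjoint balls have total mass at most 1, and a ball of radius
    \<open>\<rho> i\<close> centred in \<open>X\<close> has mass at least half of
    \<open>\<rho> i powr t\<close>; the surplus exponent \<open>s - t\<close> leaves a factor that
    vanishes with \<open>\<delta>\<close>.\<close>
  have pre: "packing_pre_delta s \<delta> X \<le> ennreal (K \<delta>)" if \<delta>: "0 < \<delta>" "\<delta> < 1" for \<delta>
    unfolding packing_pre_delta_def
  proof (intro Sup_least)
    fix S assume "S \<in> {(\<Sum>i. ennreal ((2 * \<rho> i) powr s)) | c \<rho>.
      (\<forall>i. c i \<in> X \<and> 0 \<le> \<rho> i \<and> \<rho> i \<le> \<delta>) \<and>
      (\<forall>i j. i \<noteq> j \<and> 0 < \<rho> i \<and> 0 < \<rho> j \<longrightarrow> cball (c i) (\<rho> i) \<inter> cball (c j) (\<rho> j) = {})}"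
    then obtain c \<rho> where S: "S = (\<Sum>i. ennreal ((2 * \<rho> i) powr s))"
      and c: "\<And>i. c i \<in> X" and \<rho>: "\<And>i. 0 \<le> \<rho> i" "\<And>i. \<rho> i \<le> \<delta>"
      and disj: "\<And>i j. i \<noteq> j \<Longrightarrow> 0 < \<rho> i \<Longrightarrow> 0 < \<rho> j \<Longrightarrow> cball (c i) (\<rho> i) \<inter> cball (c j) (\<rho> j) = {}"
      by blast
    \<comment> \<open>Entries of radius 0 are dummies whose centres may repeat; giving them the
      empty set keeps the family disjoint.\<close>
    define T where "T i = (if 0 < \<rho> i then cball (c i) (\<rho> i) else {})" for i
    have K: "0 \<le> K \<delta>" by (simp add: K_def)
    have T: "T i \<in> sets \<nu>" for i by (simp add: T_def)
    have "(2 * \<rho> i) powr s \<le> K \<delta> * measure \<nu> (T i)" for i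
    proof (cases "0 < \<rho> i")
      case True
      then obtain n where n: "len (Suc n) \<le> \<rho> i" "\<rho> i < len n"
        using len_bracket[of "\<rho> i"] \<rho>(2)[of i] \<delta> by auto
      have "(2 * \<rho> i) powr s = 2 powr s * (\<rho> i powr (s - t) * \<rho> i powr t)"
        using True by (simp add: powr_mult flip: powr_add)
      also have "\<dots> \<le> 2 powr s * (\<delta> powr (s - t) * (1/2) ^ n)"
      proof (intro mult_left_mono mult_mono)
        show "\<rho> i powr (s - t) \<le> \<delta> powr (s - t)" using t \<rho> by (intro powr_mono2) auto
        have "\<rho> i powr t \<le> len n powr t" using t \<rho> n by (intro powr_mono2) auto
        also have "\<dots> \<le> (1/2) ^ n" by (rule len_powr_le_half_power[OF t_def])
        finally show "\<rho> i powr t \<le> (1/2) ^ n" .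
      qed auto
      also have "\<dots> = K \<delta> * (1/2) ^ Suc n" by (simp add: K_def)
      also have "\<dots> \<le> K \<delta> * measure \<nu> (T i)"
        using \<nu>.measure_cball_ge[OF c n(1)] True K
        by (intro mult_left_mono) (auto simp: T_def weight_half length_code c)
      finally show ?thesis .
    next
      case False
      then have "\<rho> i = 0" using \<rho>(1)[of i] by simp
      then show ?thesis using K by simp
    qed
    then have "S \<le> (\<Sum>i. ennreal (K \<delta>) * emeasure \<nu> (T i))"
      unfolding S using K
      by (intro suminf_le) (auto simp: \<nu>.emeasure_eq_measure ennreal_mult[symmetric] intro!: ennreal_leI)
    also have "\<dots> = ennreal (K \<delta>) * emeasure \<nu> (\<Union>i. T i)"
    proof -
      have "disjoint_family T" using disj by (auto simp: disjoint_family_on_def T_def)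
      then show ?thesis using T by (subst ennreal_suminf_cmult) (simp add: suminf_emeasure image_subset_iff)
    qed
    also have "\<dots> \<le> ennreal (K \<delta>) * 1" by (intro mult_left_mono \<nu>.measure_le_1) auto
    finally show "S \<le> ennreal (K \<delta>)" by simp
  qed
  have "packing_premeasure s X \<le> 0"
  proof (rule ennreal_le_epsilon)
    fix e :: real assume "0 < e"
    define c where "c = e / (2 powr s * 2)"
    have "0 < c" using \<open>0 < e\<close> by (simp add: c_def)
    \<comment> \<open>Solves \<open>\<delta> powr (s - t) \<le> c\<close>, while staying below 1 as
      \<open>pre\<close> requires.\<close>
    define \<delta> where "\<delta> = min (1/2) (c powr (1 / (s - t)))"
    have \<delta>: "0 < \<delta>" "\<delta> < 1" using \<open>0 < c\<close> by (auto simp: \<delta>_def)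
    have "\<delta> powr (s - t) \<le> (c powr (1 / (s - t))) powr (s - t)"
      using \<delta> t by (intro powr_mono2) (auto simp: \<delta>_def)
    also have "\<dots> = c" using t \<open>0 < c\<close> by (simp add: powr_powr)
    finally have "K \<delta> \<le> 2 powr s * 2 * c" unfolding K_def by (intro mult_left_mono) auto
    also have "\<dots> = e" by (simp add: c_def)
    finally have "K \<delta> \<le> e" .
    have "packing_premeasure s X \<le> packing_pre_delta s \<delta> X"
      unfolding packing_premeasure_def using \<delta> by (intro INF_lower) auto
    also have "\<dots> \<le> ennreal (K \<delta>)" by (rule pre[OF \<delta>])
    also have "\<dots> \<le> 0 + ennreal e" using \<open>K \<delta> \<le> e\<close> by (simp add: ennreal_leI)
    finally show "packing_premeasure s X \<le> 0 + ennreal e" .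
  qed
  then have 0: "packing_premeasure s X = 0" by simp
  define F where "F i = (if i = 0 then X else {})" for i :: nat
  have "packing_measure s X \<le> (\<Sum>i. packing_premeasure s (F i))"
    unfolding packing_measure_def
    by (intro Inf_lower CollectI exI[of _ F] conjI refl) (auto simp: F_def)
  also have "(\<lambda>i. packing_premeasure s (F i)) = (\<lambda>i. 0)"
    by (auto simp: F_def 0 packing_premeasure_empty)
  finally show ?thesis by simp
qed

text \<open>Baire's argument: if no piece met all subcylinders of some cylinder, nested cylinders
  could be chosen that avoid \<open>F 0\<close>, \<open>F 1\<close>, ... in turn, and a common point
  would lie in \<open>X\<close> but in no piece.\<close>

lemma cover_dense_in_cylinder:
  fixes F :: "nat \<Rightarrow> real set"
  assumes "X \<subseteq> (\<Union>i. F i)"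
  obtains i w where "\<And>v. I (w @ v) \<inter> F i \<noteq> {}"
proof (rule ccontr)
  assume "\<not> thesis"
  then have "\<forall>i w. \<exists>v. I (w @ v) \<inter> F i = {}" using that by blast
  then obtain g where g: "\<And>i w. I (w @ g i w) \<inter> F i = {}" by metis
  \<comment> \<open>The extra letter makes the words grow even where \<open>g\<close> returns the
    empty word, so the common point has cylinders of all levels.\<close>
  define W where "W = rec_nat [] (\<lambda>i w. (w @ g i w) @ [True])"
  have W_Suc: "W (Suc i) = (W i @ g i (W i)) @ [True]" for i by (simp add: W_def)
  have len_W: "i \<le> length (W i)" for i
    by (induction i) (auto simp: W_Suc)
  have "I (W (Suc i)) \<subseteq> I (W i)" for i
    using I_append_subset[of "W i" "g i (W i) @ [True]"] by (simp add: W_Suc)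
  then have anti: "I (W n) \<subseteq> I (W m)" if "m \<le> n" for m n
    using lift_Suc_antimono_le[of "\<lambda>i. I (W i)" m n] that by blast
  have "(\<Inter>i. I (W i)) \<noteq> {}"
    by (rule compact_nest) (use anti left_end_in in \<open>auto simp: I_eq\<close>)
  then obtain x where x: "\<And>i. x \<in> I (W i)" by blast
  have "x \<in> X" unfolding X_iff
  proof
    fix n
    have "length (take n (W n)) = n" using len_W[of n] by simp
    then show "\<exists>w. length w = n \<and> x \<in> I w" using I_take_subset[of "W n" n] x by blast
  qed
  then obtain i where "x \<in> F i" using assms by blast
  moreover have "x \<in> I (W i @ g i (W i))"
    using x[of "Suc i"] I_snoc_subset[of "W i @ g i (W i)" True] by (auto simp: W_Suc)
  ultimately show False using g by blast
qed

text \<open>A point of \<open>E\<close> from each subcylinder of level \<open>n\<close> gives well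
  separated centres; the resulting packing sum is at least a constant times
  \<open>2 ^ n * len n powr s\<close>, which is unbounded by
  \<open>two_power_len_large\<close>.\<close>

lemma packing_premeasure_top:
  assumes s: "0 \<le> s" "s < ln 2 / ln B" and dense: "\<And>v. I (w @ v) \<inter> E \<noteq> {}"
  shows "packing_premeasure s E = top"
proof -
  have "ennreal K \<le> packing_pre_delta s \<delta> E" if "0 < \<delta>" for \<delta> K
  proof -
    \<comment> \<open>Collects the factors that do not depend on \<open>n\<close>: the scale of the
      radii and the restriction to words extending \<open>w\<close>.\<close>
    define c0 where "c0 = (2 * gap / 3) powr s / 2 ^ length w"
    have c0: "0 < c0" using gap_pos by (simp add: c0_def)
    have "(\<lambda>n. len (n - 1)) \<longlonglongrightarrow> 0"
      using len_tendsto_0 filterlim_minus_const_nat_at_top by (rule filterlim_compose)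
    then have "(\<lambda>n. gap * len (n - 1) / 3) \<longlonglongrightarrow> gap * 0 / 3" by (intro tendsto_intros) auto
    then have "\<forall>\<^sub>F n in sequentially. gap * len (n - 1) / 3 < \<delta>"
      using \<open>0 < \<delta>\<close> by (intro order_tendstoD(2)[where a = \<delta>]) auto
    then have "\<forall>\<^sub>F n in sequentially. gap * len (n - 1) / 3 < \<delta> \<and> Suc (length w) \<le> n"
      using eventually_ge_at_top by (rule eventually_conj)
    with two_power_len_large[OF s(2)]
    have "\<exists>\<^sub>F n in sequentially. (gap * len (n - 1) / 3 < \<delta> \<and> Suc (length w) \<le> n) \<and> K / c0 \<le> 2 ^ n * len n powr s"
      by (rule frequently_eventually_conj)
    then obtain n where n: "K / c0 \<le> 2 ^ n * len n powr s" "gap * len (n - 1) / 3 < \<delta>" "Suc (length w) \<le> n"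
      using frequently_ex by blast
    define m where "m = n - length w"
    \<comment> \<open>A third of the separation at level \<open>n\<close>, so that two radii
      together stay strictly below the distance of the centres.\<close>
    define r where "r = gap * len (n - 1) / 3"
    have r: "0 < r" "r \<le> \<delta>" using gap_pos len_pos n by (auto simp: r_def)
    obtain f :: "nat \<Rightarrow> bool list" where f: "bij_betw f {..<2 ^ m} {v. length v = m}" by (rule enumerate_words)
    have lenf: "length (f i) = m" if "i < 2 ^ m" for i
      using bij_betwE[OF f] that by auto
    define pick where "pick v = (SOME y. y \<in> I (w @ v) \<inter> E)" for v
    have pick: "pick v \<in> I (w @ v) \<inter> E" for v
      unfolding pick_def some_in_eq by (rule dense)
    \<comment> \<open>Beyond \<open>2 ^ m\<close> the words \<open>f i\<close> are unspecified, but
      \<open>pick\<close> still yields points of \<open>E\<close>, as a packing demands; their radii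
      are set to 0.\<close>
    define c where "c i = pick (f i)" for i
    define \<rho> where "\<rho> i = (if i < 2 ^ m then r else 0)" for i :: nat
    have disj: "cball (c i) (\<rho> i) \<inter> cball (c j) (\<rho> j) = {}" if "i \<noteq> j" "0 < \<rho> i" "0 < \<rho> j" for i j
    proof -
      have ij: "i < 2 ^ m" "j < 2 ^ m" using that by (auto simp: \<rho>_def split: if_splits)
      then have "f i \<noteq> f j" using f that(1) by (auto simp: bij_betw_def inj_on_def)
      then have "gap * len (n - 1) \<le> \<bar>c i - c j\<bar>"
        using I_separated[of "w @ f i" "n - 1" "w @ f j" "c i" "c j"] pick lenf ij n
        by (auto simp: c_def m_def)
      then have "3 * r \<le> dist (c i) (c j)" by (simp add: r_def dist_real_def)
      then show ?thesis using r ij by (intro disjoint_cballI) (simp add: \<rho>_def)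
    qed
    have "K \<le> c0 * (2 ^ n * len n powr s)" using n(1) c0 by (simp add: field_simps)
    also have "\<dots> = 2 ^ m * ((2 * gap / 3) powr s * len n powr s)"
      using n(3) by (simp add: c0_def m_def power_diff)
    also have "\<dots> = 2 ^ m * (2 * gap / 3 * len n) powr s"
      using gap_pos len_pos[of n] by (subst powr_mult) auto
    also have "\<dots> \<le> 2 ^ m * (2 * r) powr s"
      using gap_pos len_pos[of n] len_antimono[of "n - 1" n] s
      by (intro mult_left_mono powr_mono2) (auto simp: r_def)
    finally have K: "K \<le> 2 ^ m * (2 * r) powr s" .
    have "(\<Sum>i. ennreal ((2 * \<rho> i) powr s)) = (\<Sum>i<2 ^ m. ennreal ((2 * \<rho> i) powr s))"
      by (rule suminf_finite) (auto simp: \<rho>_def)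
    also have "\<dots> = (\<Sum>i<(2::nat) ^ m. ennreal ((2 * r) powr s))"
      by (intro sum.cong) (auto simp: \<rho>_def)
    also have "\<dots> = ennreal (\<Sum>i<(2::nat) ^ m. (2 * r) powr s)"
      by (rule sum_ennreal) auto
    also have "\<dots> = ennreal (2 ^ m * (2 * r) powr s)"
      by simp
    finally have "ennreal K \<le> (\<Sum>i. ennreal ((2 * \<rho> i) powr s))"
      using K by (simp add: ennreal_leI)
    also have "\<dots> \<le> packing_pre_delta s \<delta> E"
      unfolding packing_pre_delta_def
    proof (rule Sup_upper, rule CollectI, rule exI[of _ c], rule exI[of _ \<rho>], intro conjI refl allI impI)
      fix i j
      show "c i \<in> E" using pick by (auto simp: c_def)
      show "0 \<le> \<rho> i" "\<rho> i \<le> \<delta>" using r \<open>0 < \<delta>\<close> by (auto simp: \<rho>_def)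
      show "cball (c i) (\<rho> i) \<inter> cball (c j) (\<rho> j) = {}" if "i \<noteq> j \<and> 0 < \<rho> i \<and> 0 < \<rho> j"
        using disj that by blast
    qed
    finally show ?thesis .
  qed
  then have "ennreal K \<le> packing_premeasure s E" for K
    unfolding packing_premeasure_def by (intro INF_greatest) auto
  then have "of_nat n \<le> packing_premeasure s E" for n
    by (metis ennreal_of_nat_eq_real_of_nat)
  then show ?thesis
    by (meson ennreal_Ex_less_of_nat less_top linorder_not_less)
qed

text \<open>Some piece of any countable cover meets all subcylinders of a cylinder, and this piece
  alone has infinite premeasure.\<close>

lemma packing_measure_nonzero:
  assumes s: "0 \<le> s" "s < ln 2 / ln B"
  shows "packing_measure s X \<noteq> 0"
proof -
  have "packing_measure s X = top"
    unfolding packing_measure_def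
  proof (intro top_le Inf_greatest)
    fix S assume "S \<in> {(\<Sum>i. packing_premeasure s (F i)) | F :: nat \<Rightarrow> real set. X \<subseteq> (\<Union>i. F i)}"
    then obtain F where S: "S = (\<Sum>i. packing_premeasure s (F i))" and cover: "X \<subseteq> (\<Union>i. F i)" by blast
    obtain i w where "\<And>v. I (w @ v) \<inter> F i \<noteq> {}" using cover_dense_in_cylinder[OF cover] by blast
    then have "packing_premeasure s (F i) = top" using packing_premeasure_top s by blast
    moreover have "packing_premeasure s (F i) \<le> S"
      unfolding S using sum_le_suminf[of "\<lambda>i. packing_premeasure s (F i)" "{i}"] by simp
    ultimately show "top \<le> S" by simp
  qed
  then show ?thesis by simp
qed

lemma packing_dim_X: "packing_dim X = ereal (ln 2 / ln B)"
proof (rule antisym)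
  have pos: "0 < ln 2 / ln B" using ln_ratio_pos by simp
  show "packing_dim X \<le> ereal (ln 2 / ln B)"
  proof (rule ereal_le_epsilon2)
    fix e :: real assume "0 < e"
    then have "packing_measure (ln 2 / ln B + e) X = 0" by (intro packing_measure_eq_0) simp
    then have "packing_dim X \<le> ereal (ln 2 / ln B + e)"
      unfolding packing_dim_def using pos \<open>0 < e\<close> by (intro Inf_lower) auto
    then show "packing_dim X \<le> ereal (ln 2 / ln B) + ereal e" by simp
  qed
  show "ereal (ln 2 / ln B) \<le> packing_dim X"
    unfolding packing_dim_def
  proof (intro Inf_greatest)
    fix y assume "y \<in> {ereal s | s. 0 \<le> s \<and> packing_measure s X = 0}"
    then obtain s where s: "y = ereal s" "0 \<le> s" "packing_measure s X = 0" by blast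
    then have "\<not> s < ln 2 / ln B" using packing_measure_nonzero by blast
    then show "ereal (ln 2 / ln B) \<le> y" by (simp add: s(1))
  qed
qed

end

theorem theorem2p1:
  fixes A B p q :: real and N :: "nat \<Rightarrow> nat" and \<mu> :: "real measure"
  assumes AB: "A > B" "B > 2"
    and pq: "0 < p" "p \<le> 1/2" "0 < q" "q \<le> 1/2"
    and N: "strict_mono N" "N 0 = 0"
    and Nlim: "filterlim (\<lambda>i. real (N (Suc i)) / real (N i)) at_top sequentially"
    and dimcond: "- ln p / ln A < - ln (1 - q) / ln B"
    and mu_borel: "sets \<mu> = sets borel"
    and mu_prob: "prob_space \<mu>"
    and mu_cyl: "\<forall>w. measure \<mu> (cyl A B N w) = weight p q N w"
  shows
    "(\<forall>x\<in>cantorX A B N.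
        ereal (- ln (1 - p) / ln A) \<le> lower_local_dim \<mu> x \<and>
        lower_local_dim \<mu> x \<le> ereal (- ln p / ln A) \<and>
        ereal (- ln (1 - q) / ln B) \<le> upper_local_dim \<mu> x \<and>
        upper_local_dim \<mu> x \<le> ereal (- ln q / ln B))
     \<and> (\<forall>x\<in>cantorX A B N. lower_local_dim \<mu> x < upper_local_dim \<mu> x)
     \<and> (AE x in \<mu>. lower_local_dim \<mu> x = ereal (entropy p / ln A) \<and>
                    upper_local_dim \<mu> x = ereal (entropy q / ln B))
     \<and> hausdorff_dim (cantorX A B N) = ereal (ln 2 / ln A)
     \<and> ln 2 / ln A < ln 2 / ln B
     \<and> packing_dim (cantorX A B N) = ereal (ln 2 / ln B)"
proof -
  interpret K: cantor_measure A B N p q \<mu>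
    by (intro cantor_measure.intro cantor_scheme.intro cantor_measure_axioms.intro)
      (rule AB pq N Nlim mu_borel mu_prob mu_cyl[rule_format])+
  have lt: "ereal (- ln p / ln A) < ereal (- ln (1 - q) / ln B)" using dimcond by simp
  \<comment> \<open>The assumed inequality separates the upper bound for the lower dimension from
    the lower bound for the upper dimension.\<close>
  have strict: "lower_local_dim \<mu> x < upper_local_dim \<mu> x" if "x \<in> cantorX A B N" for x
    using K.local_dim_bounds(2,3)[OF that dimcond] lt by (meson le_less_trans less_le_trans)
  have "ln 2 / ln A < ln 2 / ln B"
    using K.ln_ratio_pos by (intro divide_strict_left_mono) auto
  then show ?thesis
    using K.local_dim_bounds[OF _ dimcond] strict K.AE_local_dim[OF dimcond]
      K.hausdorff_dim_X K.packing_dim_X by blast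
qed

end
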